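(* Let $n\ge 1$ and $\alpha>0$. Let $H$ be any separable (complex) Hilbert space of entire functions in $\mathbb{C}^n$ satisfying: (a) $H$ contains all constant functions; (b) for all $a\in\mathbb{C}^n$ and $f\in H$, one has $T_af\in H$ and $\|T_af\|_H=\|f\|_H$; (c) $f\mapsto f(0)$ is a bounded linear functional on $H$. Then $H=F^2_\alpha$ (as sets of functions) and there exists a positive constant $c$ such that $\langle f,g\rangle_H=c\,\langle f,g\rangle_\alpha$ for all $f$ and $g$ in $H$.
   Context: For $z=(z_1,\dots,z_n)$ and $a=(a_1,\dots,a_n)$ in $\mathbb{C}^n$ write $z\overline a=z_1\overline a_1+\cdots+z_n\overline a_n$ and $|z|^2=z\overline z$. Let $dv$ be Lebesgue volume measure on $\mathbb{C}^n$ and $d\lambda_\alpha(z)=\left(\frac{\alpha}{\pi}\right)^n e^{-\alpha|z|^2}\,dv(z)$. The Fock space $F^2_\alpha$ is the space of all entire functions $f$ on $\mathbb{C}^n$ with $\int_{\mathbb{C}^n}|f|^2\,d\lambda_\alpha<\infty$; it is a Hilbert space with inner product $\langle f,g\rangle_\alpha=\int_{\mathbb{C}^n}f(z)\overline{g(z)}\,d\lambda_\alpha(z)$. For $a\in\mathbb{C}^n$ the weighted translation operator $T_a$ acts on entire functions by $T_af(z)=e^{\alpha z\overline a-\frac{\alpha}{2}|a|^2}f(z-a)$. A Hilbert space of entire functions is a Hilbert space whose elements are entire functions on $\mathbb{C}^n$, with pointwise linear operations. *)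

theory Defs
  imports "HOL-Analysis.Analysis"
begin

section \<open>Entire functions on complex n-space\<close>

text \<open>
  A function of several complex variables is entire iff it is complex differentiable everywhere,
  i.e. its Frechet derivative exists at every point and is complex linear
  (\<^const>\<open>has_derivative\<close> by itself only gives real linearity).
\<close>

definition entire :: "(complex ^ 'n \<Rightarrow> complex) \<Rightarrow> bool" where
  "entire f \<longleftrightarrow>
     (\<forall>z. \<exists>D. (f has_derivative D) (at z) \<and> (\<forall>c v. D (c *s v) = c * D v))"

definition hermitian_dot :: "complex ^ 'n \<Rightarrow> complex ^ 'n \<Rightarrow> complex" where
  "hermitian_dot z a = (\<Sum>i\<in>UNIV. z $ i * cnj (a $ i))"

lemma hermitian_dot_self: "hermitian_dot z z = of_real ((norm z)\<^sup>2)"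
  by (simp add: hermitian_dot_def norm_vec_def L2_set_def sum_nonneg complex_norm_square
      del: of_real_power)


section \<open>The Fock space\<close>

definition gaussian_measure :: "real \<Rightarrow> (complex ^ 'n) measure" where
  "gaussian_measure \<alpha> =
     density lborel (\<lambda>z. ennreal ((\<alpha> / pi) ^ CARD('n) * exp (- \<alpha> * (norm z)\<^sup>2)))"

definition fock_space :: "real \<Rightarrow> (complex ^ 'n \<Rightarrow> complex) set" where
  "fock_space \<alpha> = {f. entire f \<and> integrable (gaussian_measure \<alpha>) (\<lambda>z. (cmod (f z))\<^sup>2)}"

definition fock_inner ::
    "real \<Rightarrow> (complex ^ 'n \<Rightarrow> complex) \<Rightarrow> (complex ^ 'n \<Rightarrow> complex) \<Rightarrow> complex" where
  "fock_inner \<alpha> f g = (\<integral>z. f z * cnj (g z) \<partial>gaussian_measure \<alpha>)"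

definition weighted_translation ::
    "real \<Rightarrow> complex ^ 'n \<Rightarrow> (complex ^ 'n \<Rightarrow> complex) \<Rightarrow> complex ^ 'n \<Rightarrow> complex" where
  "weighted_translation \<alpha> a f =
     (\<lambda>z. exp (of_real \<alpha> * hermitian_dot z a - of_real (\<alpha> / 2 * (norm a)\<^sup>2)) * f (z - a))"


section \<open>Hilbert spaces of functions\<close>

text \<open>
  A space of functions is a carrier set \<open>H\<close> with an inner product \<open>ip\<close>, linear in its first and
  conjugate linear in its second argument; the values of \<open>ip\<close> outside \<open>H\<close> are irrelevant.
\<close>

definition ip_norm :: "('f \<Rightarrow> 'f \<Rightarrow> complex) \<Rightarrow> 'f \<Rightarrow> real" where
  "ip_norm ip f = sqrt (Re (ip f f))"

text \<open>
  The distance is set to 0 outside the carrier because the locale \<^locale>\<open>Metric_space\<close> demands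
  nonnegativity and symmetry for all arguments.
\<close>

definition ip_dist ::
    "('a \<Rightarrow> complex) set \<Rightarrow> (('a \<Rightarrow> complex) \<Rightarrow> ('a \<Rightarrow> complex) \<Rightarrow> complex) \<Rightarrow>
     ('a \<Rightarrow> complex) \<Rightarrow> ('a \<Rightarrow> complex) \<Rightarrow> real" where
  "ip_dist H ip f g = (if f \<in> H \<and> g \<in> H then ip_norm ip (\<lambda>x. f x - g x) else 0)"

locale inner_product_function_space =
  fixes H :: "('a \<Rightarrow> complex) set"
    and ip :: "('a \<Rightarrow> complex) \<Rightarrow> ('a \<Rightarrow> complex) \<Rightarrow> complex"
  assumes zero_closed: "(\<lambda>_. 0) \<in> H"
    and add_closed: "\<lbrakk>f \<in> H; g \<in> H\<rbrakk> \<Longrightarrow> (\<lambda>x. f x + g x) \<in> H"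
    and scale_closed: "f \<in> H \<Longrightarrow> (\<lambda>x. c * f x) \<in> H"
    and ip_add_left:
      "\<lbrakk>f \<in> H; g \<in> H; h \<in> H\<rbrakk> \<Longrightarrow> ip (\<lambda>x. f x + g x) h = ip f h + ip g h"
    and ip_scale_left: "\<lbrakk>f \<in> H; h \<in> H\<rbrakk> \<Longrightarrow> ip (\<lambda>x. c * f x) h = c * ip f h"
    and ip_commute: "\<lbrakk>f \<in> H; g \<in> H\<rbrakk> \<Longrightarrow> ip g f = cnj (ip f g)"
    and ip_nonneg: "f \<in> H \<Longrightarrow> 0 \<le> Re (ip f f)"
    and ip_definite: "\<lbrakk>f \<in> H; ip f f = 0\<rbrakk> \<Longrightarrow> f = (\<lambda>_. 0)"
begin

lemma diff_closed:
  assumes "f \<in> H" "g \<in> H"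
  shows "(\<lambda>x. f x - g x) \<in> H"
  using add_closed[OF assms(1) scale_closed[OF assms(2), of "-1"]] by simp

lemma ip_add_right:
  assumes "f \<in> H" "g \<in> H" "h \<in> H"
  shows "ip h (\<lambda>x. f x + g x) = ip h f + ip h g"
  using ip_commute[OF add_closed[OF assms(1,2)] assms(3)] ip_add_left[OF assms]
    ip_commute[OF assms(1,3)] ip_commute[OF assms(2,3)]
  by simp

lemma ip_scale_right:
  assumes "f \<in> H" "h \<in> H"
  shows "ip h (\<lambda>x. c * f x) = cnj c * ip h f"
  using ip_commute[OF scale_closed[OF assms(1)] assms(2)] ip_scale_left[OF assms]
    ip_commute[OF assms]
  by simp

lemma ip_self_real: "f \<in> H \<Longrightarrow> ip f f = of_real (Re (ip f f))"
  using ip_commute[of f f] by (simp add: complex_eq_iff)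

lemma ip_zero_left: "h \<in> H \<Longrightarrow> ip (\<lambda>_. 0) h = 0"
  using ip_scale_left[OF zero_closed, of h 0] by simp

lemma ip_norm_nonneg: "f \<in> H \<Longrightarrow> 0 \<le> ip_norm ip f"
  by (simp add: ip_norm_def ip_nonneg)

lemma ip_norm_sq: "f \<in> H \<Longrightarrow> (ip_norm ip f)\<^sup>2 = Re (ip f f)"
  by (simp add: ip_norm_def ip_nonneg)

lemma ip_norm_eq_0: "f \<in> H \<Longrightarrow> ip_norm ip f = 0 \<longleftrightarrow> f = (\<lambda>_. 0)"
  using ip_definite[of f] ip_self_real[of f] ip_zero_left[OF zero_closed]
  by (auto simp: ip_norm_def)

lemma Re_ip_add_scale:
  assumes "f \<in> H" "g \<in> H"
  shows "Re (ip (\<lambda>x. f x + of_real t * g x) (\<lambda>x. f x + of_real t * g x)) =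
         Re (ip f f) + 2 * t * Re (ip f g) + t\<^sup>2 * Re (ip g g)"
proof -
  note sg = scale_closed[OF assms(2), of "of_real t"]
  have "Re (ip g f) = Re (ip f g)"
    using ip_commute[OF assms] by simp
  then show ?thesis
    using assms sg
    by (simp add: ip_add_left ip_add_right ip_scale_left ip_scale_right add_closed
        power2_eq_square algebra_simps)
qed

lemma Re_ip_le_norm:
  assumes "f \<in> H" "g \<in> H"
  shows "Re (ip f g) \<le> ip_norm ip f * ip_norm ip g"
proof (cases "g = (\<lambda>_. 0)")
  case True
  then show ?thesis
    using ip_commute[OF zero_closed assms(1)] ip_zero_left[OF assms(1)] ip_zero_left[OF zero_closed]
    by (simp add: ip_norm_def)
next
  case False
  define A B C where "A = Re (ip f f)" and "B = Re (ip f g)" and "C = Re (ip g g)"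
  have C: "C > 0"
    using False assms ip_definite[of g] ip_self_real[of g] ip_nonneg[of g]
    by (force simp: C_def)
  have "0 \<le> A + 2 * (- B / C) * B + (- B / C)\<^sup>2 * C"
    using ip_nonneg[OF add_closed[OF assms(1) scale_closed[OF assms(2), of "of_real (- B / C)"]]]
      Re_ip_add_scale[OF assms, of "- B / C"]
    unfolding A_def B_def C_def by simp
  also have "\<dots> = A - B\<^sup>2 / C"
    using C by (simp add: field_simps power2_eq_square)
  finally have "B\<^sup>2 \<le> A * C"
    using C by (simp add: field_simps)
  then have "B \<le> sqrt (A * C)"
    by (rule real_le_rsqrt)
  then show ?thesis
    by (simp add: ip_norm_def A_def B_def C_def real_sqrt_mult)
qed

lemma ip_norm_triangle:
  assumes "f \<in> H" "g \<in> H"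
  shows "ip_norm ip (\<lambda>x. f x + g x) \<le> ip_norm ip f + ip_norm ip g"
proof (rule power2_le_imp_le)
  show "(ip_norm ip (\<lambda>x. f x + g x))\<^sup>2 \<le> (ip_norm ip f + ip_norm ip g)\<^sup>2"
    using Re_ip_add_scale[OF assms, of 1] Re_ip_le_norm[OF assms]
    by (simp add: ip_norm_sq assms add_closed power2_sum)
qed (simp add: ip_norm_nonneg assms)

lemma ip_norm_minus:
  assumes "f \<in> H" "g \<in> H"
  shows "ip_norm ip (\<lambda>x. f x - g x) = ip_norm ip (\<lambda>x. g x - f x)"
proof -
  have "(\<lambda>x. f x - g x) = (\<lambda>x. (-1) * (g x - f x))"
    by simp
  then show ?thesis
    using ip_scale_left[of "\<lambda>x. g x - f x" "\<lambda>x. (-1) * (g x - f x)" "-1"]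
      ip_scale_right[of "\<lambda>x. g x - f x" "\<lambda>x. g x - f x" "-1"]
      scale_closed[of "\<lambda>x. g x - f x" "-1"] diff_closed[OF assms(2,1)]
    by (simp add: ip_norm_def)
qed

sublocale Metric_space H "ip_dist H ip"
proof
  fix f g h
  show "0 \<le> ip_dist H ip f g"
    by (simp add: ip_dist_def ip_norm_nonneg diff_closed)
  show "ip_dist H ip f g = ip_dist H ip g f"
    using ip_norm_minus by (auto simp: ip_dist_def)
  show "ip_dist H ip f g = 0 \<longleftrightarrow> f = g" if "f \<in> H" "g \<in> H"
    using that by (auto simp: ip_dist_def ip_norm_eq_0 diff_closed fun_eq_iff)
  show "ip_dist H ip f h \<le> ip_dist H ip f g + ip_dist H ip g h"
    if "f \<in> H" "g \<in> H" "h \<in> H"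
    using that ip_norm_triangle[of "\<lambda>x. f x - g x" "\<lambda>x. g x - h x"]
    by (simp add: ip_dist_def diff_closed)
qed

end

locale hilbert_function_space = inner_product_function_space +
  assumes complete: "mcomplete"

locale hilbert_space_of_entire_functions = hilbert_function_space H ip
  for H :: "(complex ^ 'n \<Rightarrow> complex) set"
    and ip :: "(complex ^ 'n \<Rightarrow> complex) \<Rightarrow> (complex ^ 'n \<Rightarrow> complex) \<Rightarrow> complex" +
  assumes entire: "f \<in> H \<Longrightarrow> entire f"

text \<open>
  Evaluation at a point is linear because the operations of \<open>H\<close> are pointwise, so only
  boundedness has to be required of it.
\<close>

definition bounded_evaluation ::
    "('a \<Rightarrow> complex) set \<Rightarrow> (('a \<Rightarrow> complex) \<Rightarrow> ('a \<Rightarrow> complex) \<Rightarrow> complex) \<Rightarrow> 'a \<Rightarrow> bool" where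
  "bounded_evaluation H ip x \<longleftrightarrow> (\<exists>K. \<forall>f\<in>H. cmod (f x) \<le> K * ip_norm ip f)"

end

theory Submission
  imports Defs "HOL-Probability.Distributions" "HOL-Complex_Analysis.Cauchy_Integral_Formula"
begin

text \<open>
  Evaluation at 0 is represented by some \<open>u \<in> H\<close>, and since the weighted translations are unitary,
  evaluation at \<open>a\<close> is represented by \<open>z \<mapsto> e\<^bsup>\<alpha>z\<cdot>a\<^esup> u (z - a)\<close>, where \<open>z\<cdot>a\<close> is the Hermitian product. Hermitian
  symmetry of the reproducing kernel then reads \<open>u z = cnj (u (-z))\<close>; the left side is holomorphic and
  the right side antiholomorphic, so \<open>u\<close> is a constant, positive because \<open>1 \<in> H\<close>. Hence the
  kernel of \<open>H\<close> is a positive multiple of \<open>e\<^bsup>\<alpha>z\<cdot>w\<^esup>\<close>, which also reproduces the Fock space by the mean value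
  property. So the two inner products are proportional on the span of the kernels, which is
  dense in \<open>H\<close>. Fatou's lemma gives \<open>H \<subseteq> F\<^sup>2\<close>; conversely, each \<open>f \<in> F\<^sup>2\<close> induces a functional on the
  span that is bounded in the norm of \<open>H\<close>, and its Riesz representative is a multiple of \<open>f\<close>.
\<close>

section \<open>Gaussian measure\<close>

lemma nn_integral_lborel_translate:
  fixes c :: "'a::euclidean_space"
  assumes [measurable]: "f \<in> borel_measurable borel"
  shows "(\<integral>\<^sup>+x. f (c + x) \<partial>lborel) = (\<integral>\<^sup>+x. f x \<partial>lborel)"
proof -
  have "(\<integral>\<^sup>+x. f x \<partial>distr lborel borel ((+) c)) = (\<integral>\<^sup>+x. f (c + x) \<partial>lborel)"
    by (subst nn_integral_distr) auto
  then show ?thesis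
    by (simp add: lborel_distr_plus)
qed

text \<open>
  The image of Lebesgue measure under an isometry is again translation invariant, and
  Fubini's theorem shows that two translation invariant measures agree up to a factor; the
  factor is 1 because the unit ball is preserved.
\<close>

lemma nn_integral_lborel_isometry:
  fixes R :: "'a::euclidean_space \<Rightarrow> 'a"
  assumes R: "linear R" "\<And>x. norm (R x) = norm x"
    and f[measurable]: "f \<in> borel_measurable borel"
  shows "(\<integral>\<^sup>+x. f (R x) \<partial>lborel) = (\<integral>\<^sup>+x. f x \<partial>lborel)"
proof -
  define g :: "'a \<Rightarrow> ennreal" where "g = indicator (cball 0 1)"
  define V where "V = (\<integral>\<^sup>+x. g x \<partial>lborel)"
  have g[measurable]: "g \<in> borel_measurable borel"
    unfolding g_def by (rule borel_measurable_indicator) simp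
  have gR: "g (R x) = g x" and gm: "g (- x) = g x" for x
    using R(2) by (auto simp: g_def indicator_def)
  have V: "V = emeasure lborel (cball 0 1 :: 'a set)"
    by (simp add: V_def g_def)
  \<comment> \<open>The factor \<open>V\<close> is cancelled in \<open>ennreal\<close> at the end,
    so it must be neither 0 nor infinite.\<close>
  have "0 < measure lborel (ball 0 1 :: 'a set)"
    using content_ball_pos[of 1 "0::'a"] by simp
  moreover have "emeasure lborel (ball 0 1 :: 'a set) \<le> V"
    unfolding V by (intro emeasure_mono) auto
  ultimately have V0: "V \<noteq> 0"
    by (auto simp: measure_def)
  have Vfin: "V \<noteq> \<infinity>"
    unfolding V using emeasure_lborel_cball_finite[of "0::'a" 1] by simp
  have "bounded_linear R"
    using R(1) by (simp add: linear_conv_bounded_linear)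
  then have "continuous_on UNIV R"
    by (rule linear_continuous_on)
  then have Rm[measurable]: "R \<in> borel_measurable borel"
    by (rule borel_measurable_continuous_onI)
  have surj: "surj R"
    using R by (simp add: orthogonal_transformation_surj orthogonal_transformation)
  have "(\<integral>\<^sup>+x. f (R x) \<partial>lborel) * V = (\<integral>\<^sup>+y. (\<integral>\<^sup>+x. f (R x) * g y \<partial>lborel) \<partial>lborel)"
    by (simp add: V_def nn_integral_multc nn_integral_cmult)
  \<comment> \<open>With \<open>y = R b\<close>, translating \<open>x\<close> by \<open>b\<close>
    adds \<open>y\<close> to \<open>R x\<close>.\<close>
  also have "\<dots> = (\<integral>\<^sup>+y. (\<integral>\<^sup>+x. f (R x + y) * g y \<partial>lborel) \<partial>lborel)"
  proof (rule nn_integral_cong)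
    fix y :: 'a
    obtain b where b: "R b = y"
      using surj by (metis surjD)
    show "(\<integral>\<^sup>+x. f (R x) * g y \<partial>lborel) = (\<integral>\<^sup>+x. f (R x + y) * g y \<partial>lborel)"
      using nn_integral_lborel_translate[of "\<lambda>x. f (R x) * g y" b]
      by (simp add: linear_add[OF R(1)] b add.commute)
  qed
  also have "\<dots> = (\<integral>\<^sup>+x. (\<integral>\<^sup>+y. f (R x + y) * g y \<partial>lborel) \<partial>lborel)"
    by (rule lborel_pair.Fubini') simp
  \<comment> \<open>Substituting \<open>y - R x\<close> for \<open>y\<close> frees \<open>f\<close>
    of \<open>x\<close>; after another exchange of the integrals, the integral over \<open>x\<close>
    meets only \<open>g\<close>.\<close>
  also have "\<dots> = (\<integral>\<^sup>+x. (\<integral>\<^sup>+y. f y * g (y - R x) \<partial>lborel) \<partial>lborel)"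
  proof (rule nn_integral_cong)
    fix x :: 'a
    show "(\<integral>\<^sup>+y. f (R x + y) * g y \<partial>lborel) = (\<integral>\<^sup>+y. f y * g (y - R x) \<partial>lborel)"
      using nn_integral_lborel_translate[of "\<lambda>y. f y * g (y - R x)" "R x"] by simp
  qed
  also have "\<dots> = (\<integral>\<^sup>+y. (\<integral>\<^sup>+x. f y * g (y - R x) \<partial>lborel) \<partial>lborel)"
    by (rule lborel_pair.Fubini') simp
  also have "\<dots> = (\<integral>\<^sup>+y. f y * V \<partial>lborel)"
  proof (rule nn_integral_cong)
    fix y :: 'a
    obtain b where b: "R b = y"
      using surj by (metis surjD)
    \<comment> \<open>\<open>g\<close> is even and invariant under \<open>R\<close>, so
      \<open>y - R x\<close>, which is \<open>R (b - x)\<close>, may be replaced by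
      \<open>x - b\<close>.\<close>
    have "g (y - R x) = g (- b + x)" for x
      using gR[of "b - x"] gm[of "b - x"] by (simp add: linear_diff[OF R(1)] b)
    then have "(\<integral>\<^sup>+x. g (y - R x) \<partial>lborel) = V"
      using nn_integral_lborel_translate[of g "- b"] by (simp add: V_def)
    then show "(\<integral>\<^sup>+x. f y * g (y - R x) \<partial>lborel) = f y * V"
      by (simp add: nn_integral_cmult)
  qed
  also have "\<dots> = (\<integral>\<^sup>+y. f y \<partial>lborel) * V"
    by (simp add: nn_integral_multc)
  finally have "V * (\<integral>\<^sup>+x. f (R x) \<partial>lborel) = V * (\<integral>\<^sup>+x. f x \<partial>lborel)"
    by (simp add: mult.commute)
  then show ?thesis
    using V0 Vfin by (auto simp: ennreal_mult_cancel_left)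
qed

section \<open>The Gaussian measure: rotation invariance and finite positive mass\<close>

lemma sets_gaussian_measure [simp, measurable_cong]: "sets (gaussian_measure \<alpha>) = sets borel"
  by (simp add: gaussian_measure_def)

lemma space_gaussian_measure [simp]: "space (gaussian_measure \<alpha>) = UNIV"
  by (simp add: gaussian_measure_def)

lemma nn_integral_gaussian_measure:
  fixes f :: "complex ^ 'n \<Rightarrow> ennreal"
  assumes "f \<in> borel_measurable borel"
  shows "(\<integral>\<^sup>+z. f z \<partial>gaussian_measure \<alpha>) =
    (\<integral>\<^sup>+z. ennreal ((\<alpha> / pi) ^ CARD('n) * exp (- \<alpha> * (norm z)\<^sup>2)) * f z \<partial>lborel)"
  unfolding gaussian_measure_def using assms
  by (subst nn_integral_density) auto

text \<open>The density depends on the norm only, so the invariance of Lebesgue measure passes to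
  the Gaussian measure.\<close>

lemma distr_gaussian_measure_isometry:
  fixes R :: "complex ^ 'n \<Rightarrow> complex ^ 'n"
  assumes R: "linear R" "\<And>z. norm (R z) = norm z"
  shows "distr (gaussian_measure \<alpha>) borel R = gaussian_measure \<alpha>"
proof (rule measure_eqI)
  fix A assume "A \<in> sets (distr (gaussian_measure \<alpha>) borel R)"
  then have [measurable]: "A \<in> sets borel"
    by simp
  have "bounded_linear R"
    using R(1) by (simp add: linear_conv_bounded_linear)
  then have Rm[measurable]: "R \<in> borel_measurable borel"
    by (intro borel_measurable_continuous_onI linear_continuous_on)
  have "emeasure (distr (gaussian_measure \<alpha>) borel R) A =
      (\<integral>\<^sup>+z. indicator A z \<partial>distr (gaussian_measure \<alpha>) borel R)"
    by simp
  also have "\<dots> = (\<integral>\<^sup>+z. indicator A (R z) \<partial>gaussian_measure \<alpha>)"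
    by (subst nn_integral_distr) auto
  also have "\<dots> = (\<integral>\<^sup>+z. indicator A z \<partial>gaussian_measure \<alpha>)"
    using nn_integral_lborel_isometry[OF R, of
        "\<lambda>z. ennreal ((\<alpha> / pi) ^ CARD('n) * exp (- \<alpha> * (norm z)\<^sup>2)) * indicator A z"]
    by (simp add: nn_integral_gaussian_measure R(2) del: nn_integral_indicator)
  finally show "emeasure (distr (gaussian_measure \<alpha>) borel R) A = emeasure (gaussian_measure \<alpha>) A"
    by simp
qed simp

lemma integral_gaussian_measure_isometry:
  fixes R :: "complex ^ 'n \<Rightarrow> complex ^ 'n" and f :: "complex ^ 'n \<Rightarrow> 'b::{banach, second_countable_topology}"
  assumes R: "linear R" "\<And>z. norm (R z) = norm z"
    and f: "f \<in> borel_measurable borel"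
  shows "(\<integral>z. f (R z) \<partial>gaussian_measure \<alpha>) = (\<integral>z. f z \<partial>gaussian_measure \<alpha>)"
    and "integrable (gaussian_measure \<alpha>) (\<lambda>z. f (R z)) \<longleftrightarrow> integrable (gaussian_measure \<alpha>) f"
proof -
  have "bounded_linear R"
    using R(1) by (simp add: linear_conv_bounded_linear)
  then have Rm: "R \<in> gaussian_measure \<alpha> \<rightarrow>\<^sub>M borel"
    using borel_measurable_continuous_onI[OF linear_continuous_on] by (simp cong: measurable_cong_sets)
  show "(\<integral>z. f (R z) \<partial>gaussian_measure \<alpha>) = (\<integral>z. f z \<partial>gaussian_measure \<alpha>)"
    using integral_distr[OF Rm f] by (simp add: distr_gaussian_measure_isometry[OF R])
  show "integrable (gaussian_measure \<alpha>) (\<lambda>z. f (R z)) \<longleftrightarrow> integrable (gaussian_measure \<alpha>) f"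
    using integrable_distr_eq[OF Rm f] by (simp add: distr_gaussian_measure_isometry[OF R])
qed

lemma nn_integral_exp_square_finite:
  fixes \<alpha> :: real
  assumes "\<alpha> > 0"
  shows "(\<integral>\<^sup>+x. ennreal (exp (- \<alpha> * x\<^sup>2)) \<partial>lborel) < \<infinity>"
proof -
  \<comment> \<open>This is the deviation with \<open>1 / (2 * \<sigma>\<^sup>2) = \<alpha>\<close>,
    which makes the integrand a multiple of a normal density.\<close>
  define \<sigma> where "\<sigma> = 1 / sqrt (2 * \<alpha>)"
  have \<sigma>: "\<sigma> > 0"
    using assms by (simp add: \<sigma>_def)
  have "exp (- \<alpha> * x\<^sup>2) = sqrt (2 * pi * \<sigma>\<^sup>2) * normal_density 0 \<sigma> x" for x
    using assms by (simp add: normal_density_def \<sigma>_def power_divide field_simps)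
  moreover have "integrable lborel (\<lambda>x. sqrt (2 * pi * \<sigma>\<^sup>2) * normal_density 0 \<sigma> x)"
    using integrable_normal_density[OF \<sigma>] by (rule integrable_mult_right)
  ultimately have "integrable lborel (\<lambda>x. exp (- \<alpha> * x\<^sup>2))"
    by simp
  then show ?thesis
    by (subst (asm) integrable_iff_bounded) auto
qed

text \<open>By Pythagoras the exponential is a product of one-dimensional Gaussians over the real
  orthonormal basis. The total mass is not evaluated; it enters the reproducing formula as a
  constant.\<close>

lemma finite_gaussian_measure:
  assumes "\<alpha> > 0"
  shows "finite_measure (gaussian_measure \<alpha> :: (complex ^ 'n) measure)"
proof (rule finite_measureI)
  have "exp (- \<alpha> * (norm z)\<^sup>2) = (\<Prod>b\<in>Basis. exp (- \<alpha> * (z \<bullet> b)\<^sup>2))" for z :: "complex ^ 'n"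
  proof -
    have "(norm z)\<^sup>2 = (\<Sum>b\<in>Basis. (z \<bullet> b)\<^sup>2)"
      by (subst power2_norm_eq_inner, subst euclidean_inner) (simp add: power2_eq_square)
    then show ?thesis
      by (simp add: exp_sum sum_distrib_left flip: sum_negf)
  qed
  then have "(\<integral>\<^sup>+z. ennreal (exp (- \<alpha> * (norm z)\<^sup>2)) \<partial>(lborel :: (complex ^ 'n) measure)) =
      (\<integral>\<^sup>+z. (\<Prod>b\<in>Basis. ennreal (exp (- \<alpha> * ((z :: complex ^ 'n) \<bullet> b)\<^sup>2))) \<partial>lborel)"
    by (simp add: prod_ennreal)
  also have "\<dots> = (\<Prod>b\<in>(Basis :: (complex ^ 'n) set). \<integral>\<^sup>+x. ennreal (exp (- \<alpha> * x\<^sup>2)) \<partial>lborel)"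
    by (subst nn_integral_lborel_prod) auto
  also have "\<dots> < \<infinity>"
    using nn_integral_exp_square_finite[OF assms] by (simp add: power_less_top_ennreal)
  finally have "(\<integral>\<^sup>+z. ennreal (exp (- \<alpha> * (norm z)\<^sup>2)) \<partial>(lborel :: (complex ^ 'n) measure)) < \<infinity>" .
  moreover have "emeasure (gaussian_measure \<alpha> :: (complex ^ 'n) measure) UNIV =
      ennreal ((\<alpha> / pi) ^ CARD('n)) * (\<integral>\<^sup>+z. ennreal (exp (- \<alpha> * (norm z)\<^sup>2)) \<partial>(lborel :: (complex ^ 'n) measure))"
    using nn_integral_gaussian_measure[of "\<lambda>_. 1" \<alpha>] assms
    by (simp add: ennreal_mult nn_integral_cmult)
  ultimately show "emeasure (gaussian_measure \<alpha> :: (complex ^ 'n) measure) (space (gaussian_measure \<alpha>)) \<noteq> \<infinity>"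
    by (simp add: ennreal_mult_eq_top_iff)
qed

text \<open>A density that vanishes nowhere cannot have integral 0 against Lebesgue measure.
  Positivity lets the mass be divided out of the reproducing formula.\<close>

lemma gaussian_measure_UNIV_pos:
  assumes "\<alpha> > 0"
  shows "measure (gaussian_measure \<alpha> :: (complex ^ 'n) measure) UNIV > 0"
proof -
  interpret finite_measure "gaussian_measure \<alpha> :: (complex ^ 'n) measure"
    using finite_gaussian_measure[OF assms] .
  have "emeasure (gaussian_measure \<alpha> :: (complex ^ 'n) measure) UNIV \<noteq> 0"
  proof
    assume "emeasure (gaussian_measure \<alpha> :: (complex ^ 'n) measure) UNIV = 0"
    then have "(\<integral>\<^sup>+z. ennreal ((\<alpha> / pi) ^ CARD('n) * exp (- \<alpha> * (norm z)\<^sup>2)) \<partial>(lborel :: (complex ^ 'n) measure)) = 0"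
      using nn_integral_gaussian_measure[of "\<lambda>_ :: complex ^ 'n. 1" \<alpha>] by simp
    then have "AE z :: complex ^ 'n in lborel. ennreal ((\<alpha> / pi) ^ CARD('n) * exp (- \<alpha> * (norm z)\<^sup>2)) = 0"
      by (subst (asm) nn_integral_0_iff_AE) auto
    moreover have "ennreal ((\<alpha> / pi) ^ CARD('n) * exp (- \<alpha> * (norm z)\<^sup>2)) \<noteq> 0" for z :: "complex ^ 'n"
      using assms by (simp add: ennreal_eq_0_iff not_le)
    ultimately have "AE z :: complex ^ 'n in lborel. False"
      by simp
    then show False
      by (simp add: AE_iff_null emeasure_lborel_UNIV null_sets_def)
  qed
  then show ?thesis
    by (simp add: emeasure_eq_measure zero_less_measure_iff)
qed

section \<open>Entire functions and the mean value property\<close>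

lemma hermitian_dot_add_left: "hermitian_dot (z + z') a = hermitian_dot z a + hermitian_dot z' a"
  by (simp add: hermitian_dot_def distrib_right sum.distrib)

lemma hermitian_dot_scale_left: "hermitian_dot (c *s z) a = c * hermitian_dot z a"
  by (simp add: hermitian_dot_def sum_distrib_left mult.assoc)

lemma hermitian_dot_commute: "hermitian_dot z a = cnj (hermitian_dot a z)"
  by (simp add: hermitian_dot_def mult.commute)

lemma hermitian_dot_minus_right: "hermitian_dot z (- a) = - hermitian_dot z a"
  by (simp add: hermitian_dot_def sum_negf)

lemma hermitian_dot_diff_left: "hermitian_dot (z - z') a = hermitian_dot z a - hermitian_dot z' a"
  by (simp add: hermitian_dot_def left_diff_distrib sum_subtractf)

lemma hermitian_dot_zero [simp]: "hermitian_dot 0 a = 0" "hermitian_dot z 0 = 0"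
  by (simp_all add: hermitian_dot_def)

lemma norm_add_squared_hermitian_dot:
  "(norm (z + w))\<^sup>2 = (norm z)\<^sup>2 + (norm w)\<^sup>2 + 2 * Re (hermitian_dot z w)"
proof -
  have "complex_of_real ((norm (z + w))\<^sup>2) =
      of_real ((norm z)\<^sup>2) + of_real ((norm w)\<^sup>2) + (hermitian_dot z w + hermitian_dot w z)"
    unfolding hermitian_dot_self[symmetric]
    by (simp add: hermitian_dot_def distrib_left distrib_right sum.distrib)
  also have "hermitian_dot z w + hermitian_dot w z = of_real (2 * Re (hermitian_dot z w))"
    by (subst hermitian_dot_commute[of w]) (simp add: complex_add_cnj)
  finally show ?thesis
    by (simp only: of_real_add[symmetric] of_real_eq_iff)
qed

lemma bounded_linear_hermitian_dot: "bounded_linear (\<lambda>z. hermitian_dot z a)"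
  unfolding hermitian_dot_def
  by (intro bounded_linear_sum bounded_linear_mult_left[THEN bounded_linear_compose] bounded_linear_vec_nth)

lemma linear_vector_scalar_mult: "linear (\<lambda>z :: complex ^ 'n. c *s z)"
  by (rule linearI) (simp_all add: vec_eq_iff distrib_left)

lemma norm_vector_scalar_mult: "norm (c *s z :: complex ^ 'n) = cmod c * norm z"
  by (simp add: norm_vec_def norm_mult L2_set_right_distrib)

section \<open>Closure properties and regularity of entire functions\<close>

lemma entire_const: "entire (\<lambda>_. c)"
  unfolding entire_def by (intro allI exI[of _ "\<lambda>_. 0"]) auto

lemma entire_add:
  assumes "entire f" "entire g"
  shows "entire (\<lambda>z. f z + g z)"
  unfolding entire_def
proof
  fix z
  obtain D E where D: "(f has_derivative D) (at z)" "\<forall>c v. D (c *s v) = c * D v"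
    and E: "(g has_derivative E) (at z)" "\<forall>c v. E (c *s v) = c * E v"
    using assms by (metis entire_def)
  then show "\<exists>D. ((\<lambda>z. f z + g z) has_derivative D) (at z) \<and> (\<forall>c v. D (c *s v) = c * D v)"
    by (intro exI[of _ "\<lambda>h. D h + E h"]) (auto simp: distrib_left intro: has_derivative_add)
qed

lemma entire_mult:
  assumes "entire f" "entire g"
  shows "entire (\<lambda>z. f z * g z)"
  unfolding entire_def
proof
  fix z
  obtain D E where D: "(f has_derivative D) (at z)" "\<forall>c v. D (c *s v) = c * D v"
    and E: "(g has_derivative E) (at z)" "\<forall>c v. E (c *s v) = c * E v"
    using assms by (metis entire_def)
  have "((\<lambda>z. f z * g z) has_derivative (\<lambda>h. f z * E h + D h * g z)) (at z)"
    using D(1) E(1) by (rule has_derivative_mult)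
  then show "\<exists>D. ((\<lambda>z. f z * g z) has_derivative D) (at z) \<and> (\<forall>c v. D (c *s v) = c * D v)"
    using D(2) E(2) by (intro exI[of _ "\<lambda>h. f z * E h + D h * g z"]) (auto simp: algebra_simps)
qed

lemma entire_translate:
  assumes "entire f"
  shows "entire (\<lambda>z. f (z + w))"
  unfolding entire_def
proof
  fix z
  obtain D where D: "(f has_derivative D) (at (z + w))" "\<forall>c v. D (c *s v) = c * D v"
    using assms by (metis entire_def)
  have "((\<lambda>z. z + w) has_derivative (\<lambda>h. h)) (at z)"
    by (auto intro!: derivative_eq_intros)
  from has_derivative_compose[OF this D(1)]
  show "\<exists>D. ((\<lambda>z. f (z + w)) has_derivative D) (at z) \<and> (\<forall>c v. D (c *s v) = c * D v)"
    using D(2) by auto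
qed

lemma entire_exp_hermitian_dot: "entire (\<lambda>z. exp (c * hermitian_dot z a))"
  unfolding entire_def
proof
  fix z
  have 1: "((\<lambda>z. c * hermitian_dot z a) has_derivative (\<lambda>h. c * hermitian_dot h a)) (at z)"
    by (intro has_derivative_mult_right bounded_linear_imp_has_derivative bounded_linear_hermitian_dot)
  have 2: "(exp has_derivative (*) (exp (c * hermitian_dot z a))) (at (c * hermitian_dot z a))"
    using DERIV_exp by (simp add: has_field_derivative_def)
  from has_derivative_compose[OF 1 2]
  show "\<exists>D. ((\<lambda>z. exp (c * hermitian_dot z a)) has_derivative D) (at z) \<and> (\<forall>c v. D (c *s v) = c * D v)"
    by (intro exI[of _ "\<lambda>h. exp (c * hermitian_dot z a) * (c * hermitian_dot h a)"])
      (simp add: hermitian_dot_scale_left)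
qed

lemma entire_imp_continuous: "entire f \<Longrightarrow> continuous_on UNIV f"
  unfolding entire_def by (metis continuous_at_imp_continuous_on has_derivative_continuous)

lemma entire_imp_borel_measurable: "entire f \<Longrightarrow> f \<in> borel_measurable borel"
  by (simp add: borel_measurable_continuous_onI entire_imp_continuous)

text \<open>Gives access to one-variable theory: since the derivative \<open>D\<close> is complex
  linear, the chain rule along the line through 0 and \<open>z\<close> yields the complex derivative
  \<open>D z\<close>.\<close>

lemma entire_imp_holomorphic_on_line:
  assumes "entire f"
  shows "(\<lambda>\<zeta>. f (\<zeta> *s z)) holomorphic_on S"
proof (rule holomorphic_onI)
  fix \<zeta>
  obtain D where D: "(f has_derivative D) (at (\<zeta> *s z))" "\<forall>c v. D (c *s v) = c * D v"
    using assms by (metis entire_def)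
  have "linear (\<lambda>\<zeta>. \<zeta> *s z)"
    by (rule linearI) (simp_all add: vec_eq_iff distrib_right)
  then have "((\<lambda>\<zeta>. \<zeta> *s z) has_derivative (\<lambda>\<zeta>. \<zeta> *s z)) (at \<zeta>)"
    by (simp add: linear_imp_has_derivative)
  from has_derivative_compose[OF this D(1)]
  have "((\<lambda>\<zeta>. f (\<zeta> *s z)) has_field_derivative D z) (at \<zeta>)"
    using D(2) by (simp add: has_field_derivative_def mult_commute_abs)
  then show "(\<lambda>\<zeta>. f (\<zeta> *s z)) field_differentiable at \<zeta> within S"
    using field_differentiable_at_within field_differentiable_def by blast
qed

text \<open>Cauchy's formula on the unit circle for the restriction to a complex line; the
  derivative of the path contains the factor that cancels the denominator, so an average
  remains.\<close>

lemma entire_circle_mean: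
  assumes "entire f"
  shows "((\<lambda>t. f (cis (2 * pi * t) *s z)) has_integral f 0) {0..1}"
proof -
  define F where "F = (\<lambda>\<zeta>. f (\<zeta> *s z))"
  have "((\<lambda>\<zeta>. F \<zeta> / (\<zeta> - 0)) has_contour_integral (2 * of_real pi * \<i> * F 0)) (circlepath 0 1)"
    unfolding F_def by (intro Cauchy_integral_circlepath_simple entire_imp_holomorphic_on_line assms) simp
  then have "((\<lambda>t. F (cis (2 * pi * t)) * (2 * of_real pi * \<i>)) has_integral
      (2 * of_real pi * \<i> * F 0)) {0..1}"
    unfolding has_contour_integral vector_derivative_circlepath
    by (simp add: circlepath cis_conv_exp mult_ac)
  from has_integral_mult_left[OF this, of "1 / (2 * of_real pi * \<i>)"]
  show ?thesis
    by (simp add: F_def)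
qed

text \<open>By uniqueness, the complex linear derivative of \<open>u\<close> equals the derivative
  of the reflected conjugate, which is conjugate linear. A map that is both satisfies
  \<open>\<i> * D h = - \<i> * D h\<close>, hence vanishes.\<close>

lemma entire_eq_cnj_reflection_imp_const:
  fixes u :: "complex ^ 'n \<Rightarrow> complex"
  assumes "entire u" and sym: "\<And>z. u z = cnj (u (- z))"
  shows "u z = u 0"
proof -
  have "(u has_derivative (\<lambda>_. 0)) (at z)" for z
  proof -
    obtain D where D: "(u has_derivative D) (at z)" "\<And>c v. D (c *s v) = c * D v"
      using assms by (metis entire_def)
    obtain E where E: "(u has_derivative E) (at (- z))" "\<And>c v. E (c *s v) = c * E v"
      using assms by (metis entire_def)
    have "(uminus has_derivative uminus) (at z)"
      by (auto intro!: derivative_eq_intros)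
    from has_derivative_compose[OF this E(1)]
    have "((\<lambda>z. cnj (u (- z))) has_derivative (\<lambda>h. cnj (E (- h)))) (at z)"
      by (rule has_derivative_cnj)
    then have "(u has_derivative (\<lambda>h. cnj (E (- h)))) (at z)"
      by (simp add: sym[symmetric])
    then have DE: "D = (\<lambda>h. cnj (E (- h)))"
      using D(1) has_derivative_unique by blast
    have "D h = 0" for h
    proof -
      have "\<i> * D h = D (\<i> *s h)"
        by (simp add: D)
      also have "\<dots> = cnj (E (\<i> *s (- h)))"
        by (simp add: DE vector_smult_rneg)
      also have "\<dots> = - \<i> * D h"
        unfolding E by (simp add: DE)
      finally show ?thesis
        by (simp add: complex_eq_iff)
    qed
    then have "D = (\<lambda>_. 0)"
      by auto
    then show ?thesis
      using D(1) by simp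
  qed
  then obtain c where "\<And>x. u x = c"
    using has_derivative_zero_constant[of UNIV u] by auto
  then show ?thesis
    by simp
qed

text \<open>The measure is rotation invariant, so \<open>f\<close> may be averaged over circles around 0 first.\<close>

theorem gaussian_mean_value:
  fixes f :: "complex ^ 'n \<Rightarrow> complex"
  assumes \<alpha>: "\<alpha> > 0" and f: "entire f" and int: "integrable (gaussian_measure \<alpha>) f"
  shows "(\<integral>z. f z \<partial>gaussian_measure \<alpha>) =
    of_real (measure (gaussian_measure \<alpha> :: (complex ^ 'n) measure) UNIV) * f 0"
proof -
  let ?G = "gaussian_measure \<alpha> :: (complex ^ 'n) measure"
  \<comment> \<open>\<open>U\<close> is the uniform distribution on the unit interval;
    \<open>2 * pi * t\<close> is the angle of rotation.\<close>
  define U where "U = density lborel (\<lambda>t. ennreal (indicator {0..1::real} t))"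
  define rot where "rot = (\<lambda>t (z :: complex ^ 'n). cis (2 * pi * t) *s z)"
  have sU[simp, measurable_cong]: "sets U = sets borel"
    by (simp add: U_def)
  interpret G: finite_measure ?G
    using \<alpha> by (rule finite_gaussian_measure)
  have mU: "emeasure U (space U) = 1"
    by (simp add: U_def emeasure_density ennreal_indicator)
  interpret U: prob_space U
    using mU by (rule prob_spaceI)
  interpret UG: pair_sigma_finite U ?G ..
  have iso: "linear (rot t)" "norm (rot t z) = norm z" for t z
    by (simp_all add: rot_def norm_vector_scalar_mult linear_vector_scalar_mult)
  have "continuous_on UNIV (\<lambda>p. rot (fst p) (snd p))"
    unfolding rot_def vector_scalar_mult_def cis_conv_exp by (intro continuous_intros)
  then have cont: "continuous_on UNIV (\<lambda>p. f (rot (fst p) (snd p)))"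
    by (intro continuous_on_compose2[OF entire_imp_continuous[OF f]]) auto
  from cont have "(\<lambda>p. f (rot (fst p) (snd p))) \<in> borel_measurable (borel \<Otimes>\<^sub>M borel)"
    unfolding borel_prod by (rule borel_measurable_continuous_onI)
  moreover have "sets (U \<Otimes>\<^sub>M ?G) = sets (borel \<Otimes>\<^sub>M borel)"
    by (intro sets_pair_measure_cong) auto
  ultimately have meas: "(\<lambda>p. f (rot (fst p) (snd p))) \<in> borel_measurable (U \<Otimes>\<^sub>M ?G)"
    by (simp cong: measurable_cong_sets)
  note fm = entire_imp_borel_measurable[OF f]
  \<comment> \<open>By rotation invariance the inner integral of the norm does not depend on
    \<open>t\<close>, and a constant is integrable over a probability space.\<close>
  have "integrable (U \<Otimes>\<^sub>M ?G) (\<lambda>p. f (rot (fst p) (snd p)))"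
  proof (rule UG.Fubini_integrable[OF meas])
    show "integrable U (\<lambda>t. \<integral>z. norm (f (rot (fst (t, z)) (snd (t, z)))) \<partial>?G)"
      using integral_gaussian_measure_isometry(1)[OF iso, of "\<lambda>z. norm (f z)"] fm by simp
    show "AE t in U. integrable ?G (\<lambda>z. f (rot (fst (t, z)) (snd (t, z))))"
      using integral_gaussian_measure_isometry(2)[OF iso fm] int by simp
  qed
  then have "integrable (U \<Otimes>\<^sub>M ?G) (case_prod (\<lambda>t z. f (rot t z)))"
    by (simp add: case_prod_unfold)
  note Fubini = UG.Fubini_integral[OF this]
  \<comment> \<open>Integrating over the angle first, Cauchy's formula leaves \<open>f 0\<close> for
    each \<open>z\<close>.\<close>
  have "(\<integral>t. f (rot t z) \<partial>U) = f 0" for z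
  proof -
    have c': "continuous_on UNIV (\<lambda>t. f (rot t z))"
      using continuous_on_compose2[OF cont, of UNIV "\<lambda>t. (t, z)"] by (simp add: continuous_on_Pair)
    then have c: "continuous_on {0..1} (\<lambda>t. f (rot t z))"
      by (rule continuous_on_subset) simp
    have "(\<integral>t. f (rot t z) \<partial>U) = (LINT t:{0..1}|lborel. f (rot t z))"
      unfolding U_def set_lebesgue_integral_def
      using borel_measurable_continuous_onI[OF c'] by (subst integral_density) auto
    also have "\<dots> = integral {0..1} (\<lambda>t. f (rot t z))"
      by (rule set_borel_integral_eq_integral borel_integrable_atLeastAtMost' c)+
    also have "\<dots> = f 0"
      using entire_circle_mean[OF f, of z] by (simp add: rot_def integral_unique)
    finally show ?thesis .
  qed
  then have "(\<integral>z. (\<integral>t. f (rot t z) \<partial>U) \<partial>?G) = of_real (measure ?G UNIV) * f 0"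
    by (simp add: scaleR_conv_of_real)
  \<comment> \<open>Integrating over \<open>z\<close> first, rotation invariance removes the angle,
    and \<open>U\<close> has mass 1.\<close>
  moreover have "(\<integral>t. (\<integral>z. f (rot t z) \<partial>?G) \<partial>U) = (\<integral>z. f z \<partial>?G)"
    using integral_gaussian_measure_isometry(1)[OF iso fm] by (simp add: U.prob_space)
  ultimately show ?thesis
    using Fubini by simp
qed

section \<open>The Fock space\<close>

definition fock_kernel :: "real \<Rightarrow> complex ^ 'n \<Rightarrow> complex ^ 'n \<Rightarrow> complex" where
  "fock_kernel \<alpha> w = (\<lambda>z. exp (of_real \<alpha> * hermitian_dot z w))"

text \<open>Change of variables from \<open>z\<close> to \<open>z + w\<close>: the exponential in
  \<open>h\<close> is the ratio of the Gaussian densities at \<open>z + w\<close> and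
  \<open>z\<close>.\<close>

lemma gaussian_measure_translate:
  fixes g :: "complex ^ 'n \<Rightarrow> 'b::{banach, second_countable_topology}"
  assumes \<alpha>: "\<alpha> > 0" and g[measurable]: "g \<in> borel_measurable borel"
  defines "h \<equiv> \<lambda>w z. exp (- \<alpha> * (2 * Re (hermitian_dot z w) + (norm w)\<^sup>2)) *\<^sub>R g (z + w)"
  shows "integrable (gaussian_measure \<alpha>) (h w) \<longleftrightarrow> integrable (gaussian_measure \<alpha>) g"
    and "(\<integral>z. h w z \<partial>gaussian_measure \<alpha>) = (\<integral>z. g z \<partial>gaussian_measure \<alpha>)"
proof -
  define \<rho> where "\<rho> = (\<lambda>z :: complex ^ 'n. (\<alpha> / pi) ^ CARD('n) * exp (- \<alpha> * (norm z)\<^sup>2))"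
  have G: "gaussian_measure \<alpha> = density lborel (\<lambda>z. ennreal (\<rho> z))"
    by (simp add: gaussian_measure_def \<rho>_def)
  have \<rho>[measurable]: "\<rho> \<in> borel_measurable borel"
    by (simp add: \<rho>_def)
  have \<rho>0: "0 \<le> \<rho> z" for z
    using \<alpha> by (simp add: \<rho>_def)
  have [measurable]: "(\<lambda>z :: complex ^ 'n. hermitian_dot z w) \<in> borel_measurable borel"
    by (intro borel_measurable_continuous_onI linear_continuous_on bounded_linear_hermitian_dot)
  have h[measurable]: "h w \<in> borel_measurable borel"
    unfolding h_def by measurable
  have eq: "\<rho> z *\<^sub>R h w z = \<rho> (w + z) *\<^sub>R g (w + z)" for z
    using norm_add_squared_hermitian_dot[of z w]
    by (simp add: \<rho>_def h_def add.commute mult.assoc algebra_simps flip: exp_add)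
  have m: "(\<lambda>z. \<rho> z *\<^sub>R g z) \<in> borel_measurable borel"
    by measurable
  show "integrable (gaussian_measure \<alpha>) (h w) \<longleftrightarrow> integrable (gaussian_measure \<alpha>) g"
    using integrable_distr_eq[of "(+) w" lborel borel "\<lambda>z. \<rho> z *\<^sub>R g z"] m
    by (simp add: G integrable_density \<rho>0 eq lborel_distr_plus)
  show "(\<integral>z. h w z \<partial>gaussian_measure \<alpha>) = (\<integral>z. g z \<partial>gaussian_measure \<alpha>)"
    using integral_distr[of "(+) w" lborel borel "\<lambda>z. \<rho> z *\<^sub>R g z"] m
    by (simp add: G integral_density \<rho>0 eq lborel_distr_plus)
qed

text \<open>Translating by \<open>w\<close> turns the squared modulus of the kernel, with its
  weight, into the constant \<open>exp (\<alpha> * (norm w)\<^sup>2)\<close>, which is integrable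
  because the measure is finite.\<close>

lemma fock_kernel_in_fock_space:
  assumes "\<alpha> > 0"
  shows "fock_kernel \<alpha> w \<in> fock_space \<alpha>"
proof -
  interpret finite_measure "gaussian_measure \<alpha> :: (complex ^ 'n) measure"
    using assms by (rule finite_gaussian_measure)
  have e: "entire (fock_kernel \<alpha> w)"
    unfolding fock_kernel_def by (rule entire_exp_hermitian_dot)
  have m: "(\<lambda>z. (cmod (fock_kernel \<alpha> w z))\<^sup>2) \<in> borel_measurable borel"
    using entire_imp_borel_measurable[OF e] by measurable
  have "exp (- \<alpha> * (2 * Re (hermitian_dot z w) + (norm w)\<^sup>2)) *\<^sub>R (cmod (fock_kernel \<alpha> w (z + w)))\<^sup>2 =
      exp (\<alpha> * (norm w)\<^sup>2)" for z
  proof -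
    have "Re (of_real \<alpha> * hermitian_dot (z + w) w) = \<alpha> * (Re (hermitian_dot z w) + (norm w)\<^sup>2)"
      by (simp add: hermitian_dot_add_left hermitian_dot_self flip: of_real_power)
    then have "(cmod (fock_kernel \<alpha> w (z + w)))\<^sup>2 =
        exp (2 * (\<alpha> * (Re (hermitian_dot z w) + (norm w)\<^sup>2)))"
      by (simp add: fock_kernel_def norm_exp_eq_Re exp_double)
    moreover have "- \<alpha> * (2 * Re (hermitian_dot z w) + (norm w)\<^sup>2) +
        2 * (\<alpha> * (Re (hermitian_dot z w) + (norm w)\<^sup>2)) = \<alpha> * (norm w)\<^sup>2"
      by (simp add: algebra_simps)
    ultimately show ?thesis
      by (metis exp_add real_scaleR_def)
  qed
  then have "integrable (gaussian_measure \<alpha>) (\<lambda>z. (cmod (fock_kernel \<alpha> w z))\<^sup>2)"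
    using gaussian_measure_translate(1)[OF assms m, of w] by simp
  then show ?thesis
    using e by (simp add: fock_space_def)
qed

section \<open>Linear structure and inner product of the Fock space\<close>

lemma fock_space_entire: "f \<in> fock_space \<alpha> \<Longrightarrow> entire f"
  by (simp add: fock_space_def)

lemma fock_space_borel_measurable: "f \<in> fock_space \<alpha> \<Longrightarrow> f \<in> borel_measurable borel"
  by (simp add: fock_space_entire entire_imp_borel_measurable)

lemma fock_space_zero: "(\<lambda>_. 0) \<in> fock_space \<alpha>"
  by (simp add: fock_space_def entire_const)

lemma fock_space_add:
  assumes "f \<in> fock_space \<alpha>" "g \<in> fock_space \<alpha>"
  shows "(\<lambda>z. f z + g z) \<in> fock_space \<alpha>"
proof -
  have "entire (\<lambda>z. f z + g z)"
    using assms by (intro entire_add) (auto intro: fock_space_entire)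
  moreover have "integrable (gaussian_measure \<alpha>) (\<lambda>z. (cmod (f z + g z))\<^sup>2)"
  proof (rule Bochner_Integration.integrable_bound)
    show "integrable (gaussian_measure \<alpha>) (\<lambda>z. 2 * (cmod (f z))\<^sup>2 + 2 * (cmod (g z))\<^sup>2)"
      using assms by (simp add: fock_space_def)
    have [measurable]: "f \<in> borel_measurable borel" "g \<in> borel_measurable borel"
      using assms by (auto intro: fock_space_borel_measurable)
    show "(\<lambda>z. (cmod (f z + g z))\<^sup>2) \<in> borel_measurable (gaussian_measure \<alpha>)"
      by measurable
    have "(cmod (f z + g z))\<^sup>2 \<le> 2 * (cmod (f z))\<^sup>2 + 2 * (cmod (g z))\<^sup>2" for z
    proof -
      have "(cmod (f z + g z))\<^sup>2 \<le> (cmod (f z) + cmod (g z))\<^sup>2"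
        by (intro power_mono norm_triangle_ineq) simp
      also have "\<dots> \<le> 2 * (cmod (f z))\<^sup>2 + 2 * (cmod (g z))\<^sup>2"
        using sum_squares_bound[of "cmod (f z)" "cmod (g z)"] by (simp add: power2_sum)
      finally show ?thesis .
    qed
    then show "AE z in gaussian_measure \<alpha>. norm ((cmod (f z + g z))\<^sup>2)
        \<le> norm (2 * (cmod (f z))\<^sup>2 + 2 * (cmod (g z))\<^sup>2)"
      by simp
  qed
  ultimately show ?thesis
    by (simp add: fock_space_def)
qed

lemma fock_space_scale:
  assumes "f \<in> fock_space \<alpha>"
  shows "(\<lambda>z. c * f z) \<in> fock_space \<alpha>"
  using assms entire_mult[OF entire_const, of f c]
  by (simp add: fock_space_def norm_mult power_mult_distrib)

lemma borel_measurable_cnj [measurable (raw)]: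
  "f \<in> borel_measurable M \<Longrightarrow> (\<lambda>x. cnj (f x)) \<in> borel_measurable M"
  by (rule borel_measurable_continuous_on[OF continuous_on_cnj[OF continuous_on_id]])

lemma fock_inner_integrable:
  assumes "f \<in> fock_space \<alpha>" "g \<in> fock_space \<alpha>"
  shows "integrable (gaussian_measure \<alpha>) (\<lambda>z. f z * cnj (g z))"
proof (rule Bochner_Integration.integrable_bound)
  show "integrable (gaussian_measure \<alpha>) (\<lambda>z. (cmod (f z))\<^sup>2 + (cmod (g z))\<^sup>2)"
    using assms by (simp add: fock_space_def)
  have [measurable]: "f \<in> borel_measurable borel" "g \<in> borel_measurable borel"
    using assms by (auto intro: fock_space_borel_measurable)
  show "(\<lambda>z. f z * cnj (g z)) \<in> borel_measurable (gaussian_measure \<alpha>)"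
    by measurable
  have "cmod (f z) * cmod (g z) \<le> (cmod (f z))\<^sup>2 + (cmod (g z))\<^sup>2" for z
  proof -
    have "0 \<le> cmod (f z) * cmod (g z)"
      by simp
    then show ?thesis
      using sum_squares_bound[of "cmod (f z)" "cmod (g z)"] by linarith
  qed
  then show "AE z in gaussian_measure \<alpha>. norm (f z * cnj (g z)) \<le> norm ((cmod (f z))\<^sup>2 + (cmod (g z))\<^sup>2)"
    by (simp add: norm_mult)
qed

lemma fock_inner_self: "fock_inner \<alpha> f f = of_real (\<integral>z. (cmod (f z))\<^sup>2 \<partial>gaussian_measure \<alpha>)"
  by (simp only: fock_inner_def complex_norm_square[symmetric] integral_complex_of_real)

lemma ip_norm_fock_inner:
  "ip_norm (fock_inner \<alpha>) f = sqrt (\<integral>z. (cmod (f z))\<^sup>2 \<partial>gaussian_measure \<alpha>)"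
  by (simp add: ip_norm_def fock_inner_self)

lemma fock_inner_add_left:
  assumes "f \<in> fock_space \<alpha>" "g \<in> fock_space \<alpha>" "h \<in> fock_space \<alpha>"
  shows "fock_inner \<alpha> (\<lambda>z. f z + g z) h = fock_inner \<alpha> f h + fock_inner \<alpha> g h"
  using assms by (simp add: fock_inner_def distrib_right fock_inner_integrable)

lemma fock_inner_scale_left: "fock_inner \<alpha> (\<lambda>z. c * f z) h = c * fock_inner \<alpha> f h"
  by (simp add: fock_inner_def mult.assoc)

lemma fock_inner_commute: "fock_inner \<alpha> g f = cnj (fock_inner \<alpha> f g)"
  using Bochner_Integration.integral_cnj[of "gaussian_measure \<alpha>" "\<lambda>z. f z * cnj (g z)"]
  by (simp add: fock_inner_def mult.commute)

text \<open>Follows from the Cauchy-Schwarz inequality for nonnegative integrals applied to the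
  moduli, and so does not rest on definiteness of \<open>fock_inner\<close>.\<close>

lemma fock_inner_Cauchy_Schwarz:
  assumes "f \<in> fock_space \<alpha>" "g \<in> fock_space \<alpha>"
  shows "cmod (fock_inner \<alpha> f g) \<le> ip_norm (fock_inner \<alpha>) f * ip_norm (fock_inner \<alpha>) g"
proof -
  let ?G = "gaussian_measure \<alpha>"
  have m: "(\<lambda>z. cmod (f z)) \<in> borel_measurable ?G" "(\<lambda>z. cmod (g z)) \<in> borel_measurable ?G"
    using assms[THEN fock_space_borel_measurable] by (simp_all cong: measurable_cong_sets)
  have i: "integrable ?G (\<lambda>z. cmod (f z) * cmod (g z))"
    using integrable_norm[OF fock_inner_integrable[OF assms]] by (simp add: norm_mult)
  have i2: "integrable ?G (\<lambda>z. (cmod (f z))\<^sup>2)" "integrable ?G (\<lambda>z. (cmod (g z))\<^sup>2)"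
    using assms by (auto simp: fock_space_def)
  let ?P = "\<integral>z. cmod (f z) * cmod (g z) \<partial>?G"
  have P0: "0 \<le> ?P"
    by simp
  have "(\<integral>\<^sup>+z. ennreal (cmod (f z)) * ennreal (cmod (g z)) \<partial>?G)\<^sup>2 \<le>
      (\<integral>\<^sup>+z. (ennreal (cmod (f z)))\<^sup>2 \<partial>?G) * (\<integral>\<^sup>+z. (ennreal (cmod (g z)))\<^sup>2 \<partial>?G)"
    using m by (intro Cauchy_Schwarz_nn_integral) auto
  then have "(ennreal ?P)\<^sup>2 \<le> ennreal (\<integral>z. (cmod (f z))\<^sup>2 \<partial>?G) * ennreal (\<integral>z. (cmod (g z))\<^sup>2 \<partial>?G)"
    by (simp add: nn_integral_eq_integral i i2 ennreal_power flip: ennreal_mult)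
  then have "?P\<^sup>2 \<le> (\<integral>z. (cmod (f z))\<^sup>2 \<partial>?G) * (\<integral>z. (cmod (g z))\<^sup>2 \<partial>?G)"
    by (simp add: ennreal_power P0 flip: ennreal_mult)
  then have "?P \<le> ip_norm (fock_inner \<alpha>) f * ip_norm (fock_inner \<alpha>) g"
    unfolding ip_norm_fock_inner real_sqrt_mult[symmetric] by (rule real_le_rsqrt)
  moreover have "cmod (fock_inner \<alpha> f g) \<le> ?P"
    unfolding fock_inner_def using integral_norm_bound[of ?G "\<lambda>z. f z * cnj (g z)"]
    by (simp add: norm_mult)
  ultimately show ?thesis
    by simp
qed

text \<open>Translating the integral by \<open>w\<close> reduces the claim to the mean value property at 0.\<close>

theorem fock_inner_kernel:
  fixes f :: "complex ^ 'n \<Rightarrow> complex"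
  assumes \<alpha>: "\<alpha> > 0" and f: "f \<in> fock_space \<alpha>"
  shows "fock_inner \<alpha> f (fock_kernel \<alpha> w) =
    of_real (measure (gaussian_measure \<alpha> :: (complex ^ 'n) measure) UNIV) * f w"
proof -
  let ?k = "fock_kernel \<alpha> w"
  let ?F = "\<lambda>z. f (z + w) * exp (- of_real \<alpha> * hermitian_dot z w)"
  note k = fock_kernel_in_fock_space[OF \<alpha>, of w]
  have m: "(\<lambda>z. f z * cnj (?k z)) \<in> borel_measurable borel"
    using fock_space_borel_measurable[OF f] fock_space_borel_measurable[OF k] by measurable
  \<comment> \<open>The weight cancels the antiholomorphic part of the conjugated kernel, leaving
    the entire factor \<open>exp (- of_real \<alpha> * hermitian_dot z w)\<close>. So
    \<open>?F\<close> is entire, with value \<open>f w\<close> at 0.\<close>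
  have F: "exp (- \<alpha> * (2 * Re (hermitian_dot z w) + (norm w)\<^sup>2)) *\<^sub>R (f (z + w) * cnj (?k (z + w))) = ?F z"
    for z
  proof -
    have "of_real (- \<alpha> * (2 * Re (hermitian_dot z w) + (norm w)\<^sup>2)) +
        of_real \<alpha> * (cnj (hermitian_dot z w) + of_real ((norm w)\<^sup>2)) = - of_real \<alpha> * hermitian_dot z w"
      by (simp add: complex_eq_iff algebra_simps)
    then have "of_real (exp (- \<alpha> * (2 * Re (hermitian_dot z w) + (norm w)\<^sup>2))) * cnj (?k (z + w)) =
        exp (- of_real \<alpha> * hermitian_dot z w)"
      by (simp only: exp_of_real[symmetric] fock_kernel_def exp_cnj exp_add[symmetric]
          hermitian_dot_add_left hermitian_dot_self complex_cnj_mult complex_cnj_add complex_cnj_complex_of_real)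
    then show ?thesis
      by (simp add: scaleR_conv_of_real mult.left_commute)
  qed
  have "integrable (gaussian_measure \<alpha>) ?F"
    using gaussian_measure_translate(1)[OF \<alpha> m, of w] fock_inner_integrable[OF f k]
    unfolding F by simp
  moreover have "entire ?F"
    by (intro entire_mult entire_translate fock_space_entire[OF f] entire_exp_hermitian_dot)
  ultimately have "(\<integral>z. ?F z \<partial>gaussian_measure \<alpha>) =
      of_real (measure (gaussian_measure \<alpha> :: (complex ^ 'n) measure) UNIV) * f w"
    using gaussian_mean_value[OF \<alpha>, of ?F] by simp
  then show ?thesis
    using gaussian_measure_translate(2)[OF \<alpha> m, of w] unfolding F fock_inner_def by simp
qed

text \<open>The linear span of the kernels, built by adding one scaled kernel at a time so that
  identities on it follow by induction from a single kernel.\<close>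

inductive_set fock_kernel_span :: "real \<Rightarrow> (complex ^ 'n \<Rightarrow> complex) set" for \<alpha> where
  zero: "(\<lambda>_. 0) \<in> fock_kernel_span \<alpha>"
| step: "s \<in> fock_kernel_span \<alpha> \<Longrightarrow> (\<lambda>z. c * fock_kernel \<alpha> w z + s z) \<in> fock_kernel_span \<alpha>"

lemma fock_kernel_span_kernel: "fock_kernel \<alpha> w \<in> fock_kernel_span \<alpha>"
  using fock_kernel_span.step[OF fock_kernel_span.zero, where c = 1 and w = w] by simp

lemma fock_kernel_span_add:
  assumes "s \<in> fock_kernel_span \<alpha>" "t \<in> fock_kernel_span \<alpha>"
  shows "(\<lambda>z. s z + t z) \<in> fock_kernel_span \<alpha>"
  using assms(1)
proof induction
  case (step s c w)
  show ?case
    using fock_kernel_span.step[OF step.IH, of c w] by (simp add: add.assoc)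
qed (simp add: assms(2))

lemma fock_kernel_span_scale:
  assumes "s \<in> fock_kernel_span \<alpha>"
  shows "(\<lambda>z. c * s z) \<in> fock_kernel_span \<alpha>"
  using assms
proof induction
  case (step s c' w)
  show ?case
    using fock_kernel_span.step[OF step.IH, of "c * c'" w] by (simp add: distrib_left mult.assoc)
qed (simp add: fock_kernel_span.zero)

lemma fock_kernel_span_subset_fock_space:
  assumes "\<alpha> > 0" "s \<in> fock_kernel_span \<alpha>"
  shows "s \<in> fock_space \<alpha>"
  using assms(2)
  by induction (auto intro!: fock_space_zero fock_space_add fock_space_scale
      fock_kernel_in_fock_space assms(1))

section \<open>Riesz representation in Hilbert function spaces\<close>

context inner_product_function_space
begin

lemma ip_diff_left:
  assumes "f \<in> H" "g \<in> H" "h \<in> H"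
  shows "ip (\<lambda>x. f x - g x) h = ip f h - ip g h"
  using ip_add_left[OF assms(1) scale_closed[OF assms(2), of "-1"] assms(3)]
    ip_scale_left[OF assms(2,3), of "-1"] by simp

lemma ip_norm_scale:
  assumes "f \<in> H"
  shows "ip_norm ip (\<lambda>x. c * f x) = cmod c * ip_norm ip f"
proof -
  have "ip (\<lambda>x. c * f x) (\<lambda>x. c * f x) = of_real ((cmod c)\<^sup>2) * ip f f"
    using assms by (simp add: ip_scale_left ip_scale_right scale_closed complex_norm_square
        mult.assoc del: of_real_power)
  then show ?thesis
    by (simp add: ip_norm_def real_sqrt_mult del: of_real_power)
qed

lemma cmod_ip_le_norm:
  assumes "f \<in> H" "g \<in> H"
  shows "cmod (ip f g) \<le> ip_norm ip f * ip_norm ip g"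
proof (cases "ip f g = 0")
  case False
  \<comment> \<open>A unimodular factor that rotates \<open>ip f g\<close> onto the positive real
    axis, where the bound on real parts suffices.\<close>
  define c where "c = cnj (ip f g) / of_real (cmod (ip f g))"
  have "cnj (ip f g) * ip f g = of_real ((cmod (ip f g))\<^sup>2)"
    by (simp add: complex_norm_square mult.commute del: of_real_power)
  then have "c * ip f g = of_real (cmod (ip f g))"
    using False by (simp add: c_def power2_eq_square)
  moreover have "cmod c = 1"
    using False by (simp add: c_def norm_divide)
  ultimately show ?thesis
    using Re_ip_le_norm[OF scale_closed[OF assms(1), of c] assms(2)]
    by (simp add: ip_scale_left assms ip_norm_scale)
qed (simp add: assms ip_norm_nonneg)

lemma norm_diff_le:
  assumes "f \<in> H" "g \<in> H"
  shows "ip_norm ip f - ip_norm ip g \<le> ip_norm ip (\<lambda>x. f x - g x)"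
  using ip_norm_triangle[OF diff_closed[OF assms] assms(2)] by simp

lemma tendsto_ip_norm:
  assumes s: "\<And>n. s n \<in> H" and f: "f \<in> H" and lim: "(\<lambda>n. ip_norm ip (\<lambda>x. s n x - f x)) \<longlonglongrightarrow> 0"
  shows "(\<lambda>n. ip_norm ip (s n)) \<longlonglongrightarrow> ip_norm ip f"
proof (rule LIM_zero_cancel[OF tendsto_0_le[OF lim, where K = 1]], rule always_eventually, rule allI)
  fix n
  show "norm (ip_norm ip (s n) - ip_norm ip f) \<le> norm (ip_norm ip (\<lambda>x. s n x - f x)) * 1"
    using norm_diff_le[OF s f, of n] norm_diff_le[OF f s, of n] ip_norm_minus[OF s f, of n] by simp
qed

lemma tendsto_ip_left:
  assumes s: "\<And>n. s n \<in> H" and f: "f \<in> H" and g: "g \<in> H"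
    and lim: "(\<lambda>n. ip_norm ip (\<lambda>x. s n x - f x)) \<longlonglongrightarrow> 0"
  shows "(\<lambda>n. ip (s n) g) \<longlonglongrightarrow> ip f g"
proof (rule LIM_zero_cancel[OF tendsto_0_le[OF lim, where K = "ip_norm ip g"]],
    rule always_eventually, rule allI)
  fix n
  show "norm (ip (s n) g - ip f g) \<le> norm (ip_norm ip (\<lambda>x. s n x - f x)) * ip_norm ip g"
    using cmod_ip_le_norm[OF diff_closed[OF s f] g, of n]
    by (simp add: ip_diff_left s f g ip_norm_nonneg diff_closed)
qed

lemma parallelogram_law:
  assumes "f \<in> H" "g \<in> H"
  shows "(ip_norm ip (\<lambda>x. f x - g x))\<^sup>2 + (ip_norm ip (\<lambda>x. f x + g x))\<^sup>2 =
    2 * (ip_norm ip f)\<^sup>2 + 2 * (ip_norm ip g)\<^sup>2"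
  using assms Re_ip_add_scale[OF assms, of 1] Re_ip_add_scale[OF assms, of "-1"]
  by (simp add: ip_norm_sq add_closed diff_closed)

end

text \<open>
  The subspace \<open>S\<close> need not be closed: a minimizing sequence of
  \<open>\<parallel>s\<parallel>\<^sup>2 - 2 Re (L s)\<close> in \<open>S\<close> is Cauchy by the parallelogram law, and its limit in \<open>H\<close> represents
  \<open>L\<close> by the first variation.
\<close>

theorem (in hilbert_function_space) riesz_representation_on_subspace:
  assumes SH: "S \<subseteq> H" and S0: "(\<lambda>_. 0) \<in> S"
    and Sadd: "\<And>f g. \<lbrakk>f \<in> S; g \<in> S\<rbrakk> \<Longrightarrow> (\<lambda>x. f x + g x) \<in> S"
    and Sscale: "\<And>c f. f \<in> S \<Longrightarrow> (\<lambda>x. c * f x) \<in> S"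
    and Ladd: "\<And>f g. \<lbrakk>f \<in> S; g \<in> S\<rbrakk> \<Longrightarrow> L (\<lambda>x. f x + g x) = L f + L g"
    and Lscale: "\<And>c f. f \<in> S \<Longrightarrow> L (\<lambda>x. c * f x) = c * L f"
    and Lbound: "\<And>f. f \<in> S \<Longrightarrow> cmod (L f) \<le> K * ip_norm ip f"
  obtains h s where "h \<in> H" "\<And>f. f \<in> S \<Longrightarrow> L f = ip f h" "\<And>n. s n \<in> S"
    "(\<lambda>n. ip_norm ip (\<lambda>x. s n x - h x)) \<longlonglongrightarrow> 0"
proof -
  note inH[simp, intro] = subsetD[OF SH]
  \<comment> \<open>If \<open>h\<close> represents \<open>L\<close>, then \<open>J f\<close> is the
    squared distance from \<open>f\<close> to \<open>h\<close> minus the squared norm of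
    \<open>h\<close>, so minimizing \<open>J\<close> approximates \<open>h\<close> from within
    \<open>S\<close>.\<close>
  define J where "J f = (ip_norm ip f)\<^sup>2 - 2 * Re (L f)" for f
  define m where "m = Inf (J ` S)"
  have low: "- (K\<^sup>2) \<le> J f" if "f \<in> S" for f
  proof -
    have "Re (L f) \<le> K * ip_norm ip f"
      using Lbound[OF that] complex_Re_le_cmod order_trans by blast
    \<comment> \<open>Completing the square gives the lower bound for \<open>J\<close>.\<close>
    moreover have "0 \<le> (ip_norm ip f - K)\<^sup>2"
      by simp
    ultimately show ?thesis
      by (simp add: J_def power2_diff algebra_simps)
  qed
  then have bdd: "bdd_below (J ` S)"
    by (intro bdd_belowI2)
  have mle: "m \<le> J f" if "f \<in> S" for f
    unfolding m_def using that by (intro cInf_lower bdd) auto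
  have "\<exists>f\<in>S. J f < m + inverse (Suc n)" for n
  proof -
    have "m < m + inverse (Suc n)"
      by simp
    then obtain y where "y \<in> J ` S" "y < m + inverse (Suc n)"
      using cInf_lessD[of "J ` S"] S0 unfolding m_def by blast
    then show ?thesis
      by blast
  qed
  then obtain s where s: "\<And>n. s n \<in> S" and sJ: "\<And>n. J (s n) < m + inverse (Suc n)"
    by metis
  have sH: "s n \<in> H" for n
    using s by auto
  \<comment> \<open>The midpoint of \<open>f\<close> and \<open>g\<close> lies in \<open>S\<close>,
    so \<open>J\<close> is at least \<open>m\<close> there; the parallelogram law turns this into a
    bound on the distance.\<close>
  have close: "(ip_norm ip (\<lambda>x. f x - g x))\<^sup>2 \<le> 2 * (J f - m) + 2 * (J g - m)"
    if "f \<in> S" "g \<in> S" for f g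
  proof -
    define p where "p = (\<lambda>x. f x + g x)"
    have p: "p \<in> S"
      using that by (simp add: p_def Sadd)
    have "J (\<lambda>x. (1/2) * p x) = (ip_norm ip p)\<^sup>2 / 4 - Re (L f) - Re (L g)"
      unfolding J_def using that p
      by (subst ip_norm_scale, simp, subst Lscale, simp)
        (simp add: Ladd p_def power_divide field_simps)
    then have "4 * m \<le> (ip_norm ip p)\<^sup>2 - 4 * Re (L f) - 4 * Re (L g)"
      using mle[OF Sscale[OF p, of "1/2"]] by simp
    then show ?thesis
      using parallelogram_law[of f g] that by (simp add: J_def p_def)
  qed
  have "MCauchy s"
    unfolding MCauchy_def
  proof (intro conjI allI impI)
    show "range s \<subseteq> H"
      using sH by auto
    fix \<epsilon> :: real assume \<epsilon>: "\<epsilon> > 0"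
    \<comment> \<open>A quarter of \<open>\<epsilon>\<^sup>2\<close> matches the two factors 2 in
      \<open>close\<close>.\<close>
    then obtain N where N: "inverse (Suc N) < \<epsilon>\<^sup>2 / 4"
      using reals_Archimedean[of "\<epsilon>\<^sup>2 / 4"] by auto
    have small: "J (s n) - m < \<epsilon>\<^sup>2 / 4" if "N \<le> n" for n
    proof -
      have "inverse (real (Suc n)) \<le> inverse (real (Suc N))"
        using that by (intro le_imp_inverse_le) auto
      then have "J (s n) < m + inverse (real (Suc N))"
        using sJ[of n] by linarith
      then show ?thesis
        using N by linarith
    qed
    have "ip_dist H ip (s n) (s n') < \<epsilon>" if "N \<le> n" "N \<le> n'" for n n'
    proof -
      have "(ip_norm ip (\<lambda>x. s n x - s n' x))\<^sup>2 < \<epsilon>\<^sup>2"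
        by (rule le_less_trans[OF close[OF s s]]) (use small[OF that(1)] small[OF that(2)] in \<open>simp add: field_simps\<close>)
      then show ?thesis
        using \<epsilon> sH by (simp add: ip_dist_def power_less_imp_less_base)
    qed
    then show "\<exists>N. \<forall>n n'. N \<le> n \<longrightarrow> N \<le> n' \<longrightarrow> ip_dist H ip (s n) (s n') < \<epsilon>"
      by blast
  qed
  then obtain h where "limitin mtopology s h sequentially"
    using complete by (auto simp: mcomplete_def)
  then have h: "h \<in> H" and "\<forall>\<epsilon>>0. \<exists>N. \<forall>n\<ge>N. s n \<in> H \<and> ip_dist H ip (s n) h < \<epsilon>"
    by (auto simp: limit_metric_sequentially)
  then have lim: "(\<lambda>n. ip_norm ip (\<lambda>x. s n x - h x)) \<longlonglongrightarrow> 0"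
    using sH by (auto simp: LIMSEQ_iff ip_dist_def ip_norm_nonneg diff_closed)
  have Re_eq: "Re (L f) = Re (ip f h)" if f: "f \<in> S" for f
  proof -
    define d where "d = Re (ip h f) - Re (L f)"
    \<comment> \<open>\<open>h\<close> may lie outside \<open>S\<close>, where \<open>L\<close> is
      not controlled. The variation is therefore made at \<open>s n\<close>, whose value exceeds
      \<open>m\<close> by less than \<open>inverse (Suc n)\<close>, and \<open>n\<close> tends to
      infinity.\<close>
    have var: "0 \<le> 2 * t * d + t\<^sup>2 * Re (ip f f)" for t
    proof (rule LIMSEQ_le_const)
      have l: "(\<lambda>n. Re (ip (s n) f)) \<longlonglongrightarrow> Re (ip h f)"
        by (intro tendsto_Re tendsto_ip_left sH h lim inH f)
      have "(\<lambda>n. inverse (Suc n) + 2 * t * (Re (ip (s n) f) - Re (L f)) + t\<^sup>2 * Re (ip f f))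
        \<longlonglongrightarrow> 0 + 2 * t * (Re (ip h f) - Re (L f)) + t\<^sup>2 * Re (ip f f)"
        by (intro tendsto_add tendsto_mult tendsto_diff tendsto_const LIMSEQ_inverse_real_of_nat l)
      then show "(\<lambda>n. inverse (Suc n) + 2 * t * (Re (ip (s n) f) - Re (L f)) + t\<^sup>2 * Re (ip f f))
        \<longlonglongrightarrow> 2 * t * d + t\<^sup>2 * Re (ip f f)"
        by (simp add: d_def)
      have "0 \<le> inverse (Suc n) + 2 * t * (Re (ip (s n) f) - Re (L f)) + t\<^sup>2 * Re (ip f f)" for n
      proof -
        note tf = Sscale[OF f, of "of_real t"]
        have "J (\<lambda>x. s n x + of_real t * f x) =
            J (s n) + 2 * t * (Re (ip (s n) f) - Re (L f)) + t\<^sup>2 * Re (ip f f)"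
          using Re_ip_add_scale[OF sH inH[OF f], of n t]
          by (simp add: J_def Ladd[OF s tf] Lscale[OF f] ip_norm_sq sH add_closed inH[OF tf] algebra_simps)
        then show ?thesis
          using mle[OF Sadd[OF s tf], of n] sJ[of n] by linarith
      qed
      then show "\<exists>N. \<forall>n\<ge>N. 0 \<le> inverse (Suc n) + 2 * t * (Re (ip (s n) f) - Re (L f)) + t\<^sup>2 * Re (ip f f)"
        by blast
    qed
    have "d = 0"
    proof (rule ccontr)
      assume d: "d \<noteq> 0"
      define A where "A = Re (ip f f)"
      have A: "A \<ge> 0"
        using f by (simp add: A_def ip_nonneg)
      \<comment> \<open>The minimizer of the quadratic would be \<open>- d / A\<close>; the
        denominator \<open>A + 1\<close> also covers \<open>A = 0\<close> and still makes the value
        negative.\<close>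
      have "0 \<le> 2 * (- d / (A + 1)) * d + (- d / (A + 1))\<^sup>2 * A"
        using var[of "- d / (A + 1)"] by (simp add: A_def)
      also have "\<dots> = - (d\<^sup>2 * (A + 2) / (A + 1)\<^sup>2)"
        using A by (simp add: divide_simps) (simp add: power2_eq_square algebra_simps)
      also have "\<dots> < 0"
        using d A by simp
      finally show False
        by simp
    qed
    then show ?thesis
      using ip_commute[OF h inH[OF f]] by (simp add: d_def)
  qed
  have "L f = ip f h" if f: "f \<in> S" for f
  proof (rule complex_eqI)
    show "Re (L f) = Re (ip f h)"
      by (rule Re_eq[OF f])
    show "Im (L f) = Im (ip f h)"
      \<comment> \<open>Multiplying by \<open>\<i>\<close> moves the imaginary part, up to sign,
        into the real part.\<close>
      using Re_eq[OF Sscale[OF f, of "\<i>"]] by (simp add: Lscale f ip_scale_left h)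
  qed
  with h s lim that show thesis
    by blast
qed

section \<open>Translation invariant Hilbert spaces of entire functions\<close>

lemma weighted_translation_add:
  "weighted_translation \<alpha> a (\<lambda>z. f z + g z) =
    (\<lambda>z. weighted_translation \<alpha> a f z + weighted_translation \<alpha> a g z)"
  by (simp add: weighted_translation_def distrib_left)

lemma weighted_translation_scale:
  "weighted_translation \<alpha> a (\<lambda>z. c * f z) = (\<lambda>z. c * weighted_translation \<alpha> a f z)"
  by (simp add: weighted_translation_def mult.left_commute)

lemma weighted_translation_inverse:
  "weighted_translation \<alpha> a (weighted_translation \<alpha> (- a) f) = f"
proof
  fix z
  have "(of_real \<alpha> * hermitian_dot z a - of_real (\<alpha> / 2 * (norm a)\<^sup>2)) +
      (of_real \<alpha> * hermitian_dot (z - a) (- a) - of_real (\<alpha> / 2 * (norm (- a))\<^sup>2)) = 0"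
    by (simp add: hermitian_dot_diff_left hermitian_dot_minus_right hermitian_dot_self algebra_simps)
  then have "exp (of_real \<alpha> * hermitian_dot z a - of_real (\<alpha> / 2 * (norm a)\<^sup>2)) *
      exp (of_real \<alpha> * hermitian_dot (z - a) (- a) - of_real (\<alpha> / 2 * (norm (- a))\<^sup>2)) = 1"
    by (simp only: exp_add[symmetric] exp_zero)
  then show "weighted_translation \<alpha> a (weighted_translation \<alpha> (- a) f) z = f z"
    unfolding weighted_translation_def by (simp add: mult.assoc[symmetric])
qed

text \<open>Moves evaluation at \<open>a\<close> to 0, the point where boundedness is
  assumed.\<close>

lemma weighted_translation_eval:
  "f a = of_real (exp (\<alpha> / 2 * (norm a)\<^sup>2)) * weighted_translation \<alpha> (- a) f 0"
  unfolding weighted_translation_def hermitian_dot_zero mult_zero_right norm_minus_cancel diff_0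
    exp_minus exp_of_real by simp

section \<open>Unitarity of the translations and the reproducing kernel\<close>

locale translation_invariant_hilbert_space = hilbert_space_of_entire_functions H ip
  for H :: "(complex ^ 'n \<Rightarrow> complex) set" and ip +
  fixes \<alpha> :: real
  assumes \<alpha>: "\<alpha> > 0"
    and const_closed: "(\<lambda>_. c) \<in> H"
    and translation_closed: "f \<in> H \<Longrightarrow> weighted_translation \<alpha> a f \<in> H"
    and translation_norm: "f \<in> H \<Longrightarrow> ip_norm ip (weighted_translation \<alpha> a f) = ip_norm ip f"
    and bounded_eval: "bounded_evaluation H ip 0"
begin

text \<open>Polarization: invariance is assumed for norms, and comparing the norms of
  \<open>f\<close>, \<open>g\<close> and their sum recovers the real part of the inner
  product.\<close>

lemma translation_Re_ip:
  assumes "f \<in> H" "g \<in> H"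
  shows "Re (ip (weighted_translation \<alpha> a f) (weighted_translation \<alpha> a g)) = Re (ip f g)"
proof -
  let ?T = "weighted_translation \<alpha> a"
  have "(ip_norm ip (?T (\<lambda>z. f z + g z)))\<^sup>2 = (ip_norm ip (\<lambda>z. f z + g z))\<^sup>2"
    using assms by (simp add: translation_norm add_closed)
  moreover have "(ip_norm ip (?T f))\<^sup>2 = (ip_norm ip f)\<^sup>2" "(ip_norm ip (?T g))\<^sup>2 = (ip_norm ip g)\<^sup>2"
    using assms by (simp_all add: translation_norm)
  ultimately show ?thesis
    using assms Re_ip_add_scale[of f g 1] Re_ip_add_scale[of "?T f" "?T g" 1]
    by (simp add: ip_norm_sq add_closed translation_closed weighted_translation_add)
qed

lemma translation_ip:
  assumes "f \<in> H" "g \<in> H"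
  shows "ip (weighted_translation \<alpha> a f) (weighted_translation \<alpha> a g) = ip f g"
proof (rule complex_eqI)
  show "Im (ip (weighted_translation \<alpha> a f) (weighted_translation \<alpha> a g)) = Im (ip f g)"
    using translation_Re_ip[OF scale_closed[OF assms(1), of "\<i>"] assms(2), of a] assms
    by (simp add: weighted_translation_scale ip_scale_left translation_closed)
qed (rule translation_Re_ip[OF assms])

lemma reproducing_kernel:
  obtains C where "C > 0" "\<And>w. fock_kernel \<alpha> w \<in> H"
    "\<And>f w. f \<in> H \<Longrightarrow> ip f (fock_kernel \<alpha> w) = f w / of_real C"
proof -
  obtain K where "\<And>f. f \<in> H \<Longrightarrow> cmod (f 0) \<le> K * ip_norm ip f"
    using bounded_eval by (auto simp: bounded_evaluation_def)
  then obtain u where u: "u \<in> H" and repr0: "\<And>f. f \<in> H \<Longrightarrow> f 0 = ip f u"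
    using riesz_representation_on_subspace[of H "\<lambda>f. f 0" K] zero_closed add_closed scale_closed
    by (metis (no_types, lifting) order_refl)
  define k where "k = (\<lambda>a z. exp (of_real \<alpha> * hermitian_dot z a) * u (z - a))"
  have k: "k a = (\<lambda>z. of_real (exp (\<alpha> / 2 * (norm a)\<^sup>2)) * weighted_translation \<alpha> a u z)" for a
    by (simp add: k_def weighted_translation_def exp_diff exp_of_real[symmetric])
  have kH: "k a \<in> H" for a
    unfolding k by (intro scale_closed translation_closed u)
  have repr: "ip f (k a) = f a" if f: "f \<in> H" for f a
  proof -
    \<comment> \<open>Writing \<open>f\<close> as the translate by \<open>a\<close> of its translate
      by \<open>- a\<close> lets unitarity strip the translation from \<open>u\<close>.\<close>
    have "ip f (k a) = of_real (exp (\<alpha> / 2 * (norm a)\<^sup>2)) *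
        ip (weighted_translation \<alpha> a (weighted_translation \<alpha> (- a) f)) (weighted_translation \<alpha> a u)"
      by (simp add: k ip_scale_right translation_closed u f weighted_translation_inverse)
    also have "\<dots> = of_real (exp (\<alpha> / 2 * (norm a)\<^sup>2)) * weighted_translation \<alpha> (- a) f 0"
      by (simp add: translation_ip translation_closed f u repr0)
    also have "\<dots> = f a"
      by (rule weighted_translation_eval[symmetric])
    finally show ?thesis .
  qed
  have "u z = cnj (u (- z))" for z
  proof -
    \<comment> \<open>Hermitian symmetry of the kernel at the points 0 and \<open>z\<close>, where
      the exponential factors of both sides are 1.\<close>
    have "k 0 z = cnj (k z 0)"
      using repr[OF kH, of 0 z] repr[OF kH, of z 0] ip_commute[OF kH kH] by metis
    then show ?thesis
      by (simp add: k_def)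
  qed
  then have const: "u z = u 0" for z
    using entire_eq_cnj_reflection_imp_const entire[OF u] by blast
  have u0: "u 0 = ip u u"
    by (rule repr0[OF u])
  define C where "C = Re (ip u u)"
  have uC: "u z = of_real C" for z
    using const[of z] u0 ip_self_real[OF u] by (simp add: C_def)
  \<comment> \<open>Otherwise \<open>u = 0\<close> would represent evaluation at 0, and the constant
    1 would vanish there.\<close>
  have "C \<noteq> 0"
  proof
    assume "C = 0"
    then have "u = (\<lambda>_. 0)"
      using uC by auto
    then have "ip (\<lambda>_. 1) u = 0"
      using ip_commute[OF zero_closed const_closed[of 1]] ip_zero_left[OF const_closed[of 1]] by simp
    then show False
      using repr0[OF const_closed[of 1]] by simp
  qed
  then have C: "C > 0"
    using ip_nonneg[OF u] by (simp add: C_def)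
  have kC: "k w = (\<lambda>z. of_real C * fock_kernel \<alpha> w z)" for w
    by (simp add: k_def uC fock_kernel_def mult.commute)
  have fk: "fock_kernel \<alpha> w = (\<lambda>z. inverse (of_real C) * k w z)" for w
    by (rule ext) (use C in \<open>simp add: kC field_simps\<close>)
  have "fock_kernel \<alpha> w \<in> H" for w
    unfolding fk by (intro scale_closed kH)
  moreover have "ip f (fock_kernel \<alpha> w) = f w / of_real C" if "f \<in> H" for f w
    unfolding fk by (simp add: ip_scale_right kH that repr divide_inverse mult.commute)
  ultimately show thesis
    using that C by blast
qed

end

text \<open>Fatou's lemma, used to bound the Fock norm of a limit of span elements before the limit
  is known to be square integrable.\<close>

lemma nn_integral_liminf_bound:
  fixes f :: "'a \<Rightarrow> complex"
  assumes s[measurable]: "\<And>n. s n \<in> borel_measurable M"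
    and pw: "\<And>z. (\<lambda>n. s n z) \<longlonglongrightarrow> f z"
    and int: "\<And>n. (\<integral>\<^sup>+z. ennreal ((cmod (s n z))\<^sup>2) \<partial>M) = ennreal (B n)"
    and B: "B \<longlonglongrightarrow> b"
  shows "(\<integral>\<^sup>+z. ennreal ((cmod (f z))\<^sup>2) \<partial>M) \<le> ennreal b"
proof -
  have "ennreal ((cmod (f z))\<^sup>2) = liminf (\<lambda>n. ennreal ((cmod (s n z))\<^sup>2))" for z
    by (rule lim_imp_Liminf[symmetric]) (auto intro!: tendsto_intros pw)
  then have "(\<integral>\<^sup>+z. ennreal ((cmod (f z))\<^sup>2) \<partial>M) =
      (\<integral>\<^sup>+z. liminf (\<lambda>n. ennreal ((cmod (s n z))\<^sup>2)) \<partial>M)"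
    by simp
  also have "\<dots> \<le> liminf (\<lambda>n. \<integral>\<^sup>+z. ennreal ((cmod (s n z))\<^sup>2) \<partial>M)"
    by (rule nn_integral_liminf) measurable
  also have "\<dots> = ennreal b"
    unfolding int by (rule lim_imp_Liminf) (auto intro!: tendsto_intros B)
  finally show ?thesis .
qed

section \<open>Identification with the Fock space\<close>

context translation_invariant_hilbert_space
begin

theorem eq_fock_space:
  "H = fock_space \<alpha> \<and> (\<exists>c>0. \<forall>f\<in>H. \<forall>g\<in>H. ip f g = complex_of_real c * fock_inner \<alpha> f g)"
proof -
  let ?F = "fock_space \<alpha> :: (complex ^ 'n \<Rightarrow> complex) set"
  let ?S = "fock_kernel_span \<alpha> :: (complex ^ 'n \<Rightarrow> complex) set"
  obtain C where C: "C > 0" and kH: "\<And>w. fock_kernel \<alpha> w \<in> H"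
    and repr: "\<And>f w. f \<in> H \<Longrightarrow> ip f (fock_kernel \<alpha> w) = f w / of_real C"
    using reproducing_kernel by blast
  \<comment> \<open>The kernels reproduce \<open>f w\<close> with factor \<open>1 / C\<close> in
    \<open>H\<close> and with the total mass in the Fock space; \<open>c\<close> is the quotient of
    the second by the first.\<close>
  define c where "c = measure (gaussian_measure \<alpha> :: (complex ^ 'n) measure) UNIV * C"
  have c: "c > 0"
    using C gaussian_measure_UNIV_pos[OF \<alpha>, where 'n = 'n] by (simp add: c_def)
  have SF: "s \<in> ?F" if "s \<in> ?S" for s
    using that by (rule fock_kernel_span_subset_fock_space[OF \<alpha>])
  have SH: "s \<in> H" if "s \<in> ?S" for s
    using that by induction (simp_all add: zero_closed add_closed scale_closed kH)
  \<comment> \<open>For a single kernel both sides are multiples of the conjugate of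
    \<open>f w\<close>; linearity extends this to the span.\<close>
  have "fock_inner \<alpha> s f = of_real c * ip s f" if "s \<in> ?S" "f \<in> H" "f \<in> ?F" for s f
    using that(1)
  proof induction
    case zero
    show ?case
      by (simp add: fock_inner_def ip_zero_left that(2))
  next
    case (step s a w)
    let ?k = "fock_kernel \<alpha> w"
    have "fock_inner \<alpha> ?k f = cnj (fock_inner \<alpha> f ?k)"
      by (rule fock_inner_commute)
    also have "\<dots> = of_real c * cnj (ip f ?k)"
      using C that by (simp add: fock_inner_kernel[OF \<alpha>] repr c_def)
    also have "\<dots> = of_real c * ip ?k f"
      using ip_commute[OF that(2) kH] by simp
    finally have k: "fock_inner \<alpha> ?k f = of_real c * ip ?k f" .
    have "(\<lambda>z. a * ?k z) \<in> ?F"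
      by (intro fock_space_scale fock_kernel_in_fock_space \<alpha>)
    then show ?case
      using step that k
      by (simp add: fock_inner_add_left fock_inner_scale_left SF ip_add_left ip_scale_left
          scale_closed kH SH distrib_left)
  qed
  note inner_eq = this
  have norm_S: "(ip_norm (fock_inner \<alpha>) s)\<^sup>2 = c * (ip_norm ip s)\<^sup>2" if "s \<in> ?S" for s
  proof -
    have "(ip_norm (fock_inner \<alpha>) s)\<^sup>2 = Re (fock_inner \<alpha> s s)"
      by (simp add: ip_norm_def fock_inner_self)
    then show ?thesis
      using inner_eq[OF that SH SF] that by (simp add: ip_norm_sq SH)
  qed
  have represent: "\<exists>h s. h \<in> H \<and> (\<forall>f\<in>?S. L f = ip f h) \<and> (\<forall>n. s n \<in> ?S) \<and>
      (\<lambda>n. ip_norm ip (\<lambda>x. s n x - h x)) \<longlonglongrightarrow> 0"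
    if "\<And>f g. \<lbrakk>f \<in> ?S; g \<in> ?S\<rbrakk> \<Longrightarrow> L (\<lambda>x. f x + g x) = L f + L g"
      "\<And>c f. f \<in> ?S \<Longrightarrow> L (\<lambda>x. c * f x) = c * L f"
      "\<And>f. f \<in> ?S \<Longrightarrow> cmod (L f) \<le> K * ip_norm ip f" for L K
    by (rule riesz_representation_on_subspace[of ?S L K])
      (use that in \<open>auto simp: SH fock_kernel_span.zero fock_kernel_span_add fock_kernel_span_scale\<close>)
  have eval_eq: "f = g" if "f \<in> H" "g \<in> H" "\<And>s. s \<in> ?S \<Longrightarrow> ip s f = ip s g" for f g
  proof
    fix w
    have "ip f (fock_kernel \<alpha> w) = ip g (fock_kernel \<alpha> w)"
      using that(3)[OF fock_kernel_span_kernel, of w] ip_commute[OF kH that(1), of w]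
        ip_commute[OF kH that(2), of w] by simp
    then show "f w = g w"
      using C by (simp add: repr that)
  qed
  \<comment> \<open>Density of the span: the functional \<open>ip g f\<close> of \<open>g\<close> on
    the span has a representative that is a limit of span elements. It pairs with every kernel as
    \<open>f\<close> does, so it is \<open>f\<close>.\<close>
  have approx: "\<exists>s. (\<forall>n. s n \<in> ?S) \<and> (\<lambda>n. ip_norm ip (\<lambda>x. s n x - f x)) \<longlonglongrightarrow> 0" if f: "f \<in> H" for f
  proof -
    have "\<exists>h s. h \<in> H \<and> (\<forall>g\<in>?S. ip g f = ip g h) \<and> (\<forall>n. s n \<in> ?S) \<and>
        (\<lambda>n. ip_norm ip (\<lambda>x. s n x - h x)) \<longlonglongrightarrow> 0"
      using f cmod_ip_le_norm[OF SH f]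
      by (intro represent[of "\<lambda>g. ip g f" "ip_norm ip f"]) (auto simp: ip_add_left ip_scale_left SH mult.commute)
    then show ?thesis
      using eval_eq f by metis
  qed
  have HF: "f \<in> ?F \<and> (ip_norm (fock_inner \<alpha>) f)\<^sup>2 \<le> c * (ip_norm ip f)\<^sup>2" if f: "f \<in> H" for f
  proof -
    obtain s where s: "\<And>n. s n \<in> ?S" and lim: "(\<lambda>n. ip_norm ip (\<lambda>x. s n x - f x)) \<longlonglongrightarrow> 0"
      using approx[OF f] by blast
    \<comment> \<open>Convergence in \<open>H\<close> implies pointwise convergence, since
      evaluation at \<open>w\<close> is \<open>C\<close> times the pairing with a kernel.\<close>
    have pw: "(\<lambda>n. s n w) \<longlonglongrightarrow> f w" for w
      using tendsto_mult_right[OF tendsto_ip_left[OF SH[OF s] f kH lim, of w], of "of_real C"] C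
      by (simp add: repr SH[OF s] f)
    have "(\<integral>\<^sup>+z. ennreal ((cmod (f z))\<^sup>2) \<partial>gaussian_measure \<alpha>) \<le> ennreal (c * (ip_norm ip f)\<^sup>2)"
    proof (rule nn_integral_liminf_bound[OF _ pw])
      show "s n \<in> borel_measurable (gaussian_measure \<alpha>)" for n
        using fock_space_borel_measurable[OF SF[OF s]] by (simp cong: measurable_cong_sets)
      show "(\<integral>\<^sup>+z. ennreal ((cmod (s n z))\<^sup>2) \<partial>gaussian_measure \<alpha>) = ennreal (c * (ip_norm ip (s n))\<^sup>2)" for n
        using SF[OF s, of n] norm_S[OF s, of n]
        by (simp add: nn_integral_eq_integral fock_space_def ip_norm_fock_inner)
      show "(\<lambda>n. c * (ip_norm ip (s n))\<^sup>2) \<longlonglongrightarrow> c * (ip_norm ip f)\<^sup>2"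
        by (intro tendsto_intros tendsto_ip_norm SH s f lim)
    qed
    note le = this
    have "f \<in> borel_measurable borel"
      using entire[OF f] by (rule entire_imp_borel_measurable)
    then have "(\<lambda>z. (cmod (f z))\<^sup>2) \<in> borel_measurable (gaussian_measure \<alpha>)"
      by measurable
    then have i: "integrable (gaussian_measure \<alpha>) (\<lambda>z. (cmod (f z))\<^sup>2)"
      using le_less_trans[OF le] by (intro integrableI_bounded) auto
    then have "(\<integral>z. (cmod (f z))\<^sup>2 \<partial>gaussian_measure \<alpha>) \<le> c * (ip_norm ip f)\<^sup>2"
      using le c by (simp add: nn_integral_eq_integral)
    then show ?thesis
      using i entire[OF f] by (simp add: fock_space_def ip_norm_fock_inner)
  qed
  have FH: "f \<in> H" if f: "f \<in> ?F" for f
  proof -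
    have "\<exists>h s. h \<in> H \<and> (\<forall>g\<in>?S. fock_inner \<alpha> g f = ip g h) \<and> (\<forall>n. s n \<in> ?S) \<and>
        (\<lambda>n. ip_norm ip (\<lambda>x. s n x - h x)) \<longlonglongrightarrow> 0"
    proof (rule represent)
      fix g assume g: "g \<in> ?S"
      \<comment> \<open>The two norms are proportional on the span, so Cauchy-Schwarz in the Fock
        space bounds the functional in the norm of \<open>H\<close>.\<close>
      have "ip_norm (fock_inner \<alpha>) g = sqrt c * ip_norm ip g"
        using arg_cong[OF norm_S[OF g], of sqrt] c
        by (simp add: real_sqrt_mult ip_norm_nonneg SH[OF g] ip_norm_fock_inner)
      then show "cmod (fock_inner \<alpha> g f) \<le> (sqrt c * ip_norm (fock_inner \<alpha>) f) * ip_norm ip g"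
        using fock_inner_Cauchy_Schwarz[OF SF[OF g] f] by (simp add: mult_ac)
    qed (simp_all add: fock_inner_add_left fock_inner_scale_left SF f)
    then obtain h where h: "h \<in> H" and eq: "\<And>g. g \<in> ?S \<Longrightarrow> fock_inner \<alpha> g f = ip g h"
      by blast
    \<comment> \<open>Pairing with the kernel at \<open>w\<close> gives the total mass times
      \<open>f w\<close> for \<open>f\<close>, and \<open>h w / of_real C\<close> for
      \<open>h\<close>.\<close>
    have "f w = of_real (1 / c) * h w" for w
    proof -
      let ?k = "fock_kernel \<alpha> w"
      have "fock_inner \<alpha> f ?k = ip h ?k"
        using eq[OF fock_kernel_span_kernel, of w] fock_inner_commute[of \<alpha> f ?k] ip_commute[OF kH h, of w]
        by simp
      then show ?thesis
        using C c gaussian_measure_UNIV_pos[OF \<alpha>, where 'n = 'n]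
        by (simp add: fock_inner_kernel[OF \<alpha> f] repr[OF h] c_def field_simps)
    qed
    then have "f = (\<lambda>w. of_real (1 / c) * h w)"
      by auto
    then show ?thesis
      using scale_closed[OF h] by metis
  qed
  have "fock_inner \<alpha> f g = of_real c * ip f g" if f: "f \<in> H" and g: "g \<in> H" for f g
  proof -
    obtain s where s: "\<And>n. s n \<in> ?S" and lim: "(\<lambda>n. ip_norm ip (\<lambda>x. s n x - f x)) \<longlonglongrightarrow> 0"
      using approx[OF f] by blast
    \<comment> \<open>By \<open>HF\<close> the Fock norm is at most \<open>sqrt c\<close> times the
      norm of \<open>H\<close>, so \<open>fock_inner\<close> is continuous for convergence in
      \<open>H\<close>, and the identity on the span passes to the limit.\<close>
    have "(\<lambda>n. fock_inner \<alpha> (s n) g) \<longlonglongrightarrow> fock_inner \<alpha> f g"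
    proof (rule LIM_zero_cancel[OF tendsto_0_le[OF lim, where K = "sqrt c * ip_norm (fock_inner \<alpha>) g"]],
        rule always_eventually, rule allI)
      fix n
      let ?d = "\<lambda>x. s n x - f x"
      have d: "?d \<in> H"
        by (intro diff_closed SH s f)
      have "s n = (\<lambda>x. ?d x + f x)"
        by simp
      then have "fock_inner \<alpha> (s n) g = fock_inner \<alpha> ?d g + fock_inner \<alpha> f g"
        using fock_inner_add_left[of ?d \<alpha> f g] HF d f g by metis
      then have "cmod (fock_inner \<alpha> (s n) g - fock_inner \<alpha> f g) \<le>
          ip_norm (fock_inner \<alpha>) ?d * ip_norm (fock_inner \<alpha>) g"
        using fock_inner_Cauchy_Schwarz[of ?d \<alpha> g] HF d g by simp
      moreover have "(ip_norm (fock_inner \<alpha>) ?d)\<^sup>2 \<le> (sqrt c * ip_norm ip ?d)\<^sup>2"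
        using HF[OF d] c by (simp add: power_mult_distrib)
      then have "ip_norm (fock_inner \<alpha>) ?d \<le> sqrt c * ip_norm ip ?d"
        by (rule power2_le_imp_le) (simp add: c less_imp_le ip_norm_nonneg[OF d])
      then have "ip_norm (fock_inner \<alpha>) ?d * ip_norm (fock_inner \<alpha>) g \<le>
          sqrt c * ip_norm ip ?d * ip_norm (fock_inner \<alpha>) g"
        by (rule mult_right_mono) (simp add: ip_norm_fock_inner)
      ultimately show "norm (fock_inner \<alpha> (s n) g - fock_inner \<alpha> f g) \<le>
          norm (ip_norm ip ?d) * (sqrt c * ip_norm (fock_inner \<alpha>) g)"
        using ip_norm_nonneg[OF d] by (simp add: mult_ac)
    qed
    moreover have "(\<lambda>n. fock_inner \<alpha> (s n) g) \<longlonglongrightarrow> of_real c * ip f g"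
      using tendsto_mult_left[OF tendsto_ip_left[OF SH[OF s] f g lim], of "of_real c"] HF g
      by (simp add: inner_eq[OF s])
    ultimately show ?thesis
      by (rule LIMSEQ_unique)
  qed
  then have "\<forall>f\<in>H. \<forall>g\<in>H. ip f g = complex_of_real (1 / c) * fock_inner \<alpha> f g"
    using c by simp
  moreover have "1 / c > 0"
    using c by simp
  moreover have "H = ?F"
    using HF FH by auto
  ultimately show ?thesis
    by blast
qed

end

theorem theorem6:
  fixes \<alpha> :: real
    and H :: "(complex ^ 'n \<Rightarrow> complex) set"
    and ip :: "(complex ^ 'n \<Rightarrow> complex) \<Rightarrow> (complex ^ 'n \<Rightarrow> complex) \<Rightarrow> complex"
  assumes "\<alpha> > 0"
    and "hilbert_space_of_entire_functions H ip"
    and "separable_space (Metric_space.mtopology H (ip_dist H ip))"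
    and "\<And>c. (\<lambda>_. c) \<in> H"
    and "\<And>a f. f \<in> H \<Longrightarrow>
           weighted_translation \<alpha> a f \<in> H \<and>
           ip_norm ip (weighted_translation \<alpha> a f) = ip_norm ip f"
    and "bounded_evaluation H ip 0"
  shows "H = fock_space \<alpha> \<and>
         (\<exists>c>0. \<forall>f\<in>H. \<forall>g\<in>H. ip f g = complex_of_real c * fock_inner \<alpha> f g)"
proof -
  interpret hilbert_space_of_entire_functions H ip
    by (rule assms(2))
  interpret translation_invariant_hilbert_space H ip \<alpha>
    by unfold_locales (use assms in auto)
  show ?thesis
    by (rule eq_fock_space)
qed

end
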